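(* Let $\Pi$ be an arbitrary projective plane of order $p^2$, where $p\geq 7$ is prime, and let $d^\perp$ be the minimum (non-zero) weight of $\mathrm{C}(\Pi)^\perp$. Then $d^\perp=2p^2-2p+2$, or $d^\perp=2p^2-2p+4$, or $d^\perp\geq 2p^2-2p+5$. Furthermore: (1) if $d^\perp=2p^2-2p+2$, then every code word of minimum weight of $\mathrm{C}(\Pi)^\perp$ is of the form $\lambda(v_1-v_2)$ with $\lambda\in\mathbb{F}_p^*$ and $v_1,v_2$ the incidence vectors of (the point sets of) two disjoint projective planes of order $p-1$ embedded in $\Pi$; (2) if $d^\perp=2p^2-2p+4$, then every code word of minimum weight of $\mathrm{C}(\Pi)^\perp$ is of the form $\lambda(v_1-v_2)$ with $\lambda\in\mathbb{F}_p^*$ and $v_1,v_2$ the incidence vectors of (the point sets of) two disjoint antipodal planes of order $p-1$ embedded in $\Pi$. Finally, if $\Pi$ contains a Baer subplane (a subplane of order $p$), then $d^\perp\leq 2p^2-p$.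
   Context: For a projective plane $\Pi$ of order $q=p^h$ ($p$ prime), $\mathrm{C}(\Pi)$ is the $p$-ary code of $\Pi$: the $\mathbb{F}_p$-span of the incidence vectors of the lines of $\Pi$, viewed as vectors in $\mathbb{F}_p^{q^2+q+1}$ indexed by the points of $\Pi$. Its dual $\mathrm{C}(\Pi)^\perp$ is the set of vectors $v$ with $\sum_{P\in\ell}v_P=0$ in $\mathbb{F}_p$ for every line $\ell$ of $\Pi$. The weight of a vector is the number of non-zero positions. An antipodal plane of order $s\geq 2$ is a partial linear space (point set $\mathcal{P}$, line set $\mathcal{L}$, each line a subset of $\mathcal{P}$ of size at least $2$, two distinct points on at most one line) with $|\mathcal{P}|=|\mathcal{L}|=s^2+s+2$, every line containing $s+1$ points and every point on $s+1$ lines. An incidence structure $(\mathcal{P},\mathcal{L})$ is embedded in a projective plane $\Pi$ if there are injective maps from $\mathcal{P}$ to the points of $\Pi$ and from $\mathcal{L}$ to the lines of $\Pi$ preserving both incidence and non-incidence. *)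

theory Defs
  imports "Berlekamp_Zassenhaus.Finite_Field" "HOL-Library.Function_Algebras"
begin

text \<open>
  An incidence structure is a set \<open>P\<close> of points together with a set \<open>L\<close> of lines, each line being
  the set of points incident with it.
\<close>

definition projective_plane :: "'a set \<Rightarrow> 'a set set \<Rightarrow> bool" where
  "projective_plane P L \<longleftrightarrow>
     L \<subseteq> Pow P \<and>
     (\<forall>x\<in>P. \<forall>y\<in>P. x \<noteq> y \<longrightarrow> (\<exists>!l. l \<in> L \<and> x \<in> l \<and> y \<in> l)) \<and>
     (\<forall>l\<in>L. \<forall>m\<in>L. l \<noteq> m \<longrightarrow> (\<exists>!x. x \<in> l \<and> x \<in> m)) \<and>
     (\<exists>Q\<subseteq>P. card Q = 4 \<and> (\<forall>l\<in>L. card (l \<inter> Q) \<le> 2))"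

definition projective_plane_of_order :: "nat \<Rightarrow> 'a set \<Rightarrow> 'a set set \<Rightarrow> bool" where
  "projective_plane_of_order n P L \<longleftrightarrow> projective_plane P L \<and> (\<forall>l\<in>L. card l = n + 1)"

definition partial_linear_space :: "'a set \<Rightarrow> 'a set set \<Rightarrow> bool" where
  "partial_linear_space P L \<longleftrightarrow>
     L \<subseteq> Pow P \<and>
     (\<forall>l\<in>L. card l \<ge> 2) \<and>
     (\<forall>x\<in>P. \<forall>y\<in>P. x \<noteq> y \<longrightarrow> (\<forall>l\<in>L. \<forall>m\<in>L. x \<in> l \<and> y \<in> l \<and> x \<in> m \<and> y \<in> m \<longrightarrow> l = m))"

definition antipodal_plane_of_order :: "nat \<Rightarrow> 'a set \<Rightarrow> 'a set set \<Rightarrow> bool" where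
  "antipodal_plane_of_order s P L \<longleftrightarrow>
     s \<ge> 2 \<and> partial_linear_space P L \<and>
     card P = s\<^sup>2 + s + 2 \<and> card L = s\<^sup>2 + s + 2 \<and>
     (\<forall>l\<in>L. card l = s + 1) \<and>
     (\<forall>x\<in>P. card {l \<in> L. x \<in> l} = s + 1)"

definition embedding ::
  "('b \<Rightarrow> 'a) \<Rightarrow> ('b set \<Rightarrow> 'a set) \<Rightarrow> 'b set \<Rightarrow> 'b set set \<Rightarrow> 'a set \<Rightarrow> 'a set set \<Rightarrow> bool" where
  "embedding f g P' L' P L \<longleftrightarrow>
     inj_on f P' \<and> f ` P' \<subseteq> P \<and>
     inj_on g L' \<and> g ` L' \<subseteq> L \<and>
     (\<forall>x\<in>P'. \<forall>l\<in>L'. x \<in> l \<longleftrightarrow> f x \<in> g l)"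

text \<open>
  \<open>S\<close> is the set of points of \<open>(P, L)\<close> occupied by an embedded incidence structure with property
  \<open>X\<close>. Letting the abstract structure range over the point type of \<open>(P, L)\<close> loses nothing, because
  any embedded structure is isomorphic to one carried by \<open>S\<close> itself.
\<close>

definition embedded_point_set ::
  "('a set \<Rightarrow> 'a set set \<Rightarrow> bool) \<Rightarrow> 'a set \<Rightarrow> 'a set set \<Rightarrow> 'a set \<Rightarrow> bool" where
  "embedded_point_set X P L S \<longleftrightarrow>
     (\<exists>P' L' f g. X P' L' \<and> embedding f g P' L' P L \<and> S = f ` P')"

definition incidence_vector :: "'a set \<Rightarrow> 'a \<Rightarrow> 'f::field" where
  "incidence_vector S = (\<lambda>x. if x \<in> S then 1 else 0)"

definition weight :: "('a \<Rightarrow> 'f::field) \<Rightarrow> nat" where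
  "weight v = card {x. v x \<noteq> 0}"

text \<open>
  Vectors indexed by the points are functions on the point type that vanish outside \<open>P\<close>.
\<close>

definition point_vectors :: "'a set \<Rightarrow> ('a \<Rightarrow> 'f::field) set" where
  "point_vectors P = {v. \<forall>x. x \<notin> P \<longrightarrow> v x = 0}"

definition plane_code :: "'a set set \<Rightarrow> ('a \<Rightarrow> 'f::field) set" where
  "plane_code L = Modules.module.span (\<lambda>c v x. c * v x) (incidence_vector ` L)"

definition dual_plane_code :: "'a set \<Rightarrow> 'a set set \<Rightarrow> ('a \<Rightarrow> 'f::field) set" where
  "dual_plane_code P L = {v \<in> point_vectors P. \<forall>l\<in>L. (\<Sum>x\<in>l. v x) = 0}"

definition minimum_weight :: "('a \<Rightarrow> 'f::field) set \<Rightarrow> nat" where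
  "minimum_weight C = (LEAST w. \<exists>v\<in>C. v \<noteq> (\<lambda>x. 0) \<and> weight v = w)"

lemma dual_plane_code_eq_orthogonal_complement:
  fixes P :: "'a set"
  assumes "finite P" and "L \<subseteq> Pow P"
  shows "(dual_plane_code P L :: ('a \<Rightarrow> 'f::field) set) =
    {v \<in> point_vectors P. \<forall>c\<in>plane_code L. (\<Sum>x\<in>P. v x * c x) = 0}"
proof -
  interpret M: Modules.module "\<lambda>(c::'f) (v::'a \<Rightarrow> 'f) x. c * v x"
    by unfold_locales (auto simp: fun_eq_iff algebra_simps)
  have line: "(\<Sum>x\<in>P. v x * incidence_vector l x) = (\<Sum>x\<in>l. v x)" if "l \<in> L" for l and v :: "'a \<Rightarrow> 'f"
  proof -
    have "P \<inter> l = l" using that assms by auto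
    then show ?thesis
      using assms(1) by (simp add: incidence_vector_def if_distrib [of "\<lambda>t. _ * t"]
          sum.inter_restrict [symmetric] cong: if_cong)
  qed
  have "(\<Sum>x\<in>P. v x * c x) = 0"
    if v: "\<forall>l\<in>L. (\<Sum>x\<in>l. v x) = 0" and c: "c \<in> plane_code L" for v c :: "'a \<Rightarrow> 'f"
    using c unfolding plane_code_def
  proof (induction rule: M.span_induct_alt)
    case base
    show ?case by simp
  next
    case (step a b c)
    have "(\<Sum>x\<in>P. v x * b x) = 0" using step(1) v line by auto
    then have "a * (\<Sum>x\<in>P. v x * b x) + (\<Sum>x\<in>P. v x * c x) = 0" using step by simp
    then show ?case
      by (simp add: sum_distrib_left algebra_simps sum.distrib)
  qed
  moreover have "(\<Sum>x\<in>l. v x) = 0"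
    if "\<forall>c\<in>plane_code L. (\<Sum>x\<in>P. v x * c x) = 0" "l \<in> L" for v :: "'a \<Rightarrow> 'f" and l
    using that line [of l v] M.span_base [of "incidence_vector l" "incidence_vector ` L"]
    by (auto simp: plane_code_def)
  ultimately show ?thesis
    unfolding dual_plane_code_def by blast
qed

end

theory Submission
  imports Defs
begin

text \<open>
  Let \<open>v\<close> be a dual code word of weight \<open>w = 2p\<^sup>2 - 2p + 2 + \<epsilon>\<close> with \<open>\<epsilon> \<le> 2\<close>. Lifting the values of \<open>v / a\<close> to
  \<open>{0..<p}\<close>, the sum over a line through a point of symbol \<open>a\<close> is a positive multiple \<open>p (1 + j)\<close> of \<open>p\<close>.
  Counting on the lines through such a point shows that \<open>-a\<close> also occurs and that the total excess
  \<open>\<Sum> j\<close> is a number \<open>e\<^sub>a\<close> depending only on \<open>a\<close>, with \<open>e\<^sub>a + e\<^bsub>-a\<^esub> = \<epsilon>\<close>; in particular \<open>\<epsilon> \<ge> 0\<close>.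
  Write \<open>n\<^sub>a\<close> for the number of points with symbol \<open>a\<close>.

  On a line of excess 0 a lift \<open>p - i\<close> forces further lifts with sum \<open>i - 1\<close>. This makes the numbers
  \<open>n\<^sub>a + n\<^bsub>-a\<^esub>\<close> almost independent of \<open>a\<close> and leaves no gaps in the multiples \<open>a, 2a, 3a, \<dots>\<close> that occur,
  so either the symbols are just \<open>a, -a\<close> or every nonzero symbol occurs. In the latter case a
  discharging argument based on \<open>a \<mapsto> -2a\<close> forces \<open>\<epsilon> = 2\<close> and produces a line carrying precisely the symbols
  \<open>a, -2a, 4a, -8a\<close>, whose sum \<open>-5a\<close> is not 0. With only two symbols, \<open>n\<^sub>a = n\<^bsub>-a\<^esub> = p\<^sup>2 - p + 1 + \<epsilon>/2\<close>, and the
  lines cut a projective or an antipodal plane of order \<open>p - 1\<close> out of each symbol class. A Baer subplane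
  minus one of its lines is a dual code word of weight \<open>2p\<^sup>2 - p\<close>.
\<close>

subsection \<open>Residues\<close>

definition residue :: "'r::prime_card mod_ring \<Rightarrow> nat" where
  "residue x = nat (to_int_mod_ring x)"

lemma residue_less_card: "residue (x :: 'r::prime_card mod_ring) < CARD('r)"
proof -
  have "to_int_mod_ring x \<in> {0..<int CARD('r)}"
    using range_to_int_mod_ring[where ?'a='r] by blast
  then show ?thesis by (auto simp: residue_def)
qed

lemma of_nat_residue [simp]: "of_nat (residue x) = x"
proof -
  have "to_int_mod_ring x \<in> {0..<int CARD('a)}"
    using range_to_int_mod_ring[where ?'a='a] by blast
  then have "int (residue x) = to_int_mod_ring x" by (auto simp: residue_def)
  then have "of_int (int (residue x)) = (of_int_mod_ring (to_int_mod_ring x) :: 'a mod_ring)"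
    by (simp add: of_int_of_int_mod_ring)
  then show ?thesis by simp
qed

lemma of_nat_mod_ring_eq_0_iff:
  "(of_nat n :: 'r::prime_card mod_ring) = 0 \<longleftrightarrow> CARD('r) dvd n"
  using of_nat_0_mod_ring_dvd[of n] by (auto simp: dvd_def)

lemma of_nat_mod_ring_eq_iff:
  "(of_nat m :: 'r::prime_card mod_ring) = of_nat n \<longleftrightarrow> m mod CARD('r) = n mod CARD('r)"
proof (induction m n rule: linorder_wlog)
  case (le m n)
  have "(of_nat m :: 'r mod_ring) = of_nat n \<longleftrightarrow> (of_nat (n - m) :: 'r mod_ring) = 0"
    using le by (auto simp: of_nat_diff)
  also have "\<dots> \<longleftrightarrow> n mod CARD('r) = m mod CARD('r)"
    using le by (simp only: of_nat_mod_ring_eq_0_iff mod_eq_dvd_iff_nat)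
  finally show ?case by auto
qed auto

lemma residue_of_nat:
  assumes "n < CARD('r)"
  shows "residue (of_nat n :: 'r::prime_card mod_ring) = n"
proof -
  have "(of_nat (residue (of_nat n :: 'r mod_ring)) :: 'r mod_ring) = of_nat n" by simp
  then show ?thesis
    using assms residue_less_card[of "of_nat n :: 'r mod_ring"]
    unfolding of_nat_mod_ring_eq_iff by simp
qed

lemma residue_eq_iff: "residue x = residue y \<longleftrightarrow> x = y"
  by (metis of_nat_residue)

lemma residue_0 [simp]: "residue 0 = 0"
  by (simp add: residue_def zero_mod_ring.rep_eq to_int_mod_ring.rep_eq)

lemma residue_eq_0_iff [simp]: "residue x = 0 \<longleftrightarrow> x = 0"
  using residue_eq_iff[of x 0] by simp

lemma residue_1 [simp]: "residue (1 :: 'r::prime_card mod_ring) = 1"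
  using residue_of_nat[of 1, where 'r='r] nontriv[where 'a='r] by simp

lemma residue_minus:
  assumes "(x :: 'r::prime_card mod_ring) \<noteq> 0"
  shows "residue (- x) = CARD('r) - residue x"
proof -
  have pos: "residue x > 0" using assms by (simp add: Suc_leI zero_less_iff_neq_zero)
  have lt: "residue x < CARD('r)" by (rule residue_less_card)
  have "(of_nat (CARD('r) - residue x) :: 'r mod_ring) = - x"
    using lt by (simp add: of_nat_diff)
  then have "residue (- x) = residue (of_nat (CARD('r) - residue x) :: 'r mod_ring)" by simp
  also have "\<dots> = CARD('r) - residue x"
    using pos lt by (intro residue_of_nat) simp
  finally show ?thesis .
qed

lemma residue_add_residue_minus:
  assumes "(x :: 'r::prime_card mod_ring) \<noteq> 0"
  shows "residue x + residue (- x) = CARD('r)"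
  using residue_minus[OF assms] residue_less_card[of x] by simp

lemma card_nonzero_mod_ring: "card {a :: 'r::prime_card mod_ring. a \<noteq> 0} = CARD('r) - 1"
proof -
  have "{a :: 'r mod_ring. a \<noteq> 0} = UNIV - {0}" by auto
  then show ?thesis by (simp add: card_Diff_singleton)
qed

subsection \<open>Counting in finite projective planes\<close>

locale plane_of_order =
  fixes n :: nat and P :: "'a set" and L :: "'a set set"
  assumes plane: "projective_plane_of_order n P L" and n_pos: "n \<ge> 1"
begin

lemma line_subset: "l \<in> L \<Longrightarrow> l \<subseteq> P"
  using plane by (auto simp: projective_plane_of_order_def projective_plane_def)

lemma card_line: "l \<in> L \<Longrightarrow> card l = n + 1"
  using plane by (auto simp: projective_plane_of_order_def)

lemma finite_line: "l \<in> L \<Longrightarrow> finite l"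
  by (rule card_ge_0_finite) (simp add: card_line)

lemma ex1_line: "x \<in> P \<Longrightarrow> y \<in> P \<Longrightarrow> x \<noteq> y \<Longrightarrow> \<exists>!l. l \<in> L \<and> x \<in> l \<and> y \<in> l"
  using plane by (simp add: projective_plane_of_order_def projective_plane_def)

lemma ex_line:
  assumes "x \<in> P" "y \<in> P" "x \<noteq> y"
  obtains l where "l \<in> L" "x \<in> l" "y \<in> l"
  using ex1_line[OF assms] by blast

lemma line_unique:
  assumes "l \<in> L" "m \<in> L" "x \<in> l" "y \<in> l" "x \<in> m" "y \<in> m" "x \<noteq> y"
  shows "l = m"
proof -
  have "x \<in> P" "y \<in> P" using assms line_subset by auto
  then show ?thesis using ex1_line[of x y] assms by blast
qed

lemma ex1_point: "l \<in> L \<Longrightarrow> m \<in> L \<Longrightarrow> l \<noteq> m \<Longrightarrow> \<exists>!x. x \<in> l \<and> x \<in> m"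
  using plane by (simp add: projective_plane_of_order_def projective_plane_def)

lemma card_Int_lines:
  assumes "l \<in> L" "m \<in> L" "l \<noteq> m"
  shows "card (l \<inter> m) = 1"
proof -
  obtain x where "x \<in> l" "x \<in> m" "\<And>y. y \<in> l \<Longrightarrow> y \<in> m \<Longrightarrow> y = x"
    using ex1_point[OF assms] by blast
  then have "l \<inter> m = {x}" by blast
  then show ?thesis by simp
qed

lemma quadrangle:
  obtains Q where "Q \<subseteq> P" "card Q = 4" "\<And>l. l \<in> L \<Longrightarrow> card (l \<inter> Q) \<le> 2"
proof -
  have "\<exists>Q\<subseteq>P. card Q = 4 \<and> (\<forall>l\<in>L. card (l \<inter> Q) \<le> 2)"
    using plane unfolding projective_plane_of_order_def projective_plane_def by (elim conjE)
  then obtain Q where "Q \<subseteq> P" "card Q = 4" "\<forall>l\<in>L. card (l \<inter> Q) \<le> 2" by (elim exE conjE)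
  then show ?thesis using that by simp
qed

text \<open>Three quadrangle points \<open>a\<close>, \<open>b\<close>, \<open>c\<close> other than
  \<open>x\<close> are not collinear, so the lines \<open>ab\<close> and \<open>ac\<close> meet only
  in \<open>a\<close> and cannot both contain \<open>x\<close>.\<close>

lemma ex_line_avoiding:
  assumes x: "x \<in> P"
  obtains l where "l \<in> L" "x \<notin> l"
proof -
  obtain Q where Q: "Q \<subseteq> P" "card Q = 4" "\<And>l. l \<in> L \<Longrightarrow> card (l \<inter> Q) \<le> 2"
    by (rule quadrangle) blast
  have fin: "finite Q" using Q(2) by (metis card.infinite zero_neq_numeral)
  have "3 \<le> card (Q - {x})"
    using Q(2) fin by (cases "x \<in> Q") (auto simp: card_Diff_singleton)
  then obtain T where T: "T \<subseteq> Q - {x}" "card T = 3" by (meson obtain_subset_with_card_n)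
  obtain a b c where abc: "T = {a, b, c}" "a \<noteq> b" "b \<noteq> c" "a \<noteq> c"
    using T(2) by (auto simp: card_3_iff)
  have inP: "a \<in> P" "b \<in> P" "c \<in> P" using T(1) Q(1) abc by auto
  obtain l where l: "l \<in> L" "a \<in> l" "b \<in> l" by (rule ex_line[OF inP(1,2) abc(2)])
  obtain m where m: "m \<in> L" "a \<in> m" "c \<in> m" by (rule ex_line[OF inP(1,3) abc(4)])
  have "l \<noteq> m"
  proof
    assume "l = m"
    then have "T \<subseteq> l \<inter> Q" using l m abc T by auto
    then have "3 \<le> card (l \<inter> Q)" using T(2) fin by (metis card_mono finite_Int)
    then show False using Q(3)[OF l(1)] by simp
  qed
  moreover have "x \<noteq> a" using T abc by auto
  ultimately have "x \<notin> l \<or> x \<notin> m" using line_unique[of l m x a] l m by blast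
  then show ?thesis using that l m by blast
qed

text \<open>Intersecting with a fixed line off \<open>x\<close> matches the lines through
  \<open>x\<close> with the points of that line.\<close>

lemma card_pencil:
  assumes x: "x \<in> P"
  shows "card {l \<in> L. x \<in> l} = n + 1"
proof -
  obtain l where l: "l \<in> L" "x \<notin> l" by (rule ex_line_avoiding[OF x])
  define g where "g m = (THE y. y \<in> l \<and> y \<in> m)" for m
  have g: "g m \<in> l \<and> g m \<in> m" if "m \<in> L" "x \<in> m" for m
    unfolding g_def by (rule theI', rule ex1_point) (use that l in auto)
  have "bij_betw g {m \<in> L. x \<in> m} l"
    unfolding bij_betw_def
  proof
    show "inj_on g {m \<in> L. x \<in> m}"
    proof (rule inj_onI)
      fix m m' assume mm: "m \<in> {m \<in> L. x \<in> m}" "m' \<in> {m \<in> L. x \<in> m}" "g m = g m'"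
      then have "g m \<in> m" "g m \<in> m'" "g m \<noteq> x" using g[of m] g[of m'] l by auto
      then show "m = m'" using line_unique[of m m' x "g m"] mm by auto
    qed
    show "g ` {m \<in> L. x \<in> m} = l"
    proof
      show "g ` {m \<in> L. x \<in> m} \<subseteq> l" using g by auto
      show "l \<subseteq> g ` {m \<in> L. x \<in> m}"
      proof
        fix y assume y: "y \<in> l"
        then have "y \<noteq> x" "y \<in> P" using l line_subset by auto
        then obtain m where m: "m \<in> L" "x \<in> m" "y \<in> m" using ex_line[of x y] x by auto
        then have "m \<noteq> l" using l by auto
        then have "g m = y" using ex1_point[of m l] g[of m] m l y by blast
        then show "y \<in> g ` {m \<in> L. x \<in> m}" using m by auto
      qed
    qed
  qed
  then show ?thesis using card_line[OF l(1)] bij_betw_same_card by force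
qed

lemma finite_pencil: "x \<in> P \<Longrightarrow> finite {l \<in> L. x \<in> l}"
  by (rule card_ge_0_finite) (simp add: card_pencil)

lemma pencil_Union:
  assumes x: "x \<in> P"
  shows "P - {x} = (\<Union>l\<in>{l \<in> L. x \<in> l}. l - {x})"
proof
  show "P - {x} \<subseteq> (\<Union>l\<in>{l \<in> L. x \<in> l}. l - {x})"
  proof
    fix y assume "y \<in> P - {x}"
    then obtain l where "l \<in> L" "x \<in> l" "y \<in> l" using ex_line[OF x, of y] by auto
    then show "y \<in> (\<Union>l\<in>{l \<in> L. x \<in> l}. l - {x})" using \<open>y \<in> P - {x}\<close> by auto
  qed
  show "(\<Union>l\<in>{l \<in> L. x \<in> l}. l - {x}) \<subseteq> P - {x}" using line_subset by auto
qed

lemma finite_points: "finite P"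
proof -
  obtain Q where Q: "Q \<subseteq> P" "card Q = 4" by (rule quadrangle) blast
  then have "Q \<noteq> {}" by auto
  then obtain x where x: "x \<in> P" using Q by blast
  have "finite (P - {x})" unfolding pencil_Union[OF x]
    using finite_pencil[OF x] finite_line by auto
  then show ?thesis by simp
qed

lemma finite_lines: "finite L"
  using finite_points line_subset by (intro finite_subset[of L "Pow P"]) auto

lemma pencil_sum_punctured:
  fixes h :: "'a \<Rightarrow> 'b::comm_monoid_add"
  assumes x: "x \<in> P"
  shows "(\<Sum>l | l \<in> L \<and> x \<in> l. \<Sum>y\<in>l - {x}. h y) = (\<Sum>y\<in>P - {x}. h y)"
  unfolding pencil_Union[OF x]
proof (rule sum.UNION_disjoint[symmetric])
  show "finite {l \<in> L. x \<in> l}" by (rule finite_pencil[OF x])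
  show "\<forall>l\<in>{l \<in> L. x \<in> l}. finite (l - {x})" using finite_line by auto
  show "\<forall>l\<in>{l \<in> L. x \<in> l}. \<forall>m\<in>{l \<in> L. x \<in> l}. l \<noteq> m \<longrightarrow> (l - {x}) \<inter> (m - {x}) = {}"
  proof (intro ballI impI)
    fix l m assume "l \<in> {l \<in> L. x \<in> l}" "m \<in> {l \<in> L. x \<in> l}" "l \<noteq> m"
    then show "(l - {x}) \<inter> (m - {x}) = {}" using line_unique[of l m x] by auto
  qed
qed

text \<open>Each point other than \<open>x\<close> lies on exactly one of the \<open>n + 1\<close>
  lines through \<open>x\<close>, whereas \<open>x\<close> lies on all of them and is therefore
  counted \<open>n\<close> extra times.\<close>

lemma pencil_sum:
  fixes h :: "'a \<Rightarrow> 'b::comm_semiring_1"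
  assumes x: "x \<in> P"
  shows "(\<Sum>l | l \<in> L \<and> x \<in> l. \<Sum>y\<in>l. h y) = (\<Sum>y\<in>P. h y) + of_nat n * h x"
proof -
  have "sum h l = h x + sum h (l - {x})" if "l \<in> {l \<in> L. x \<in> l}" for l
  proof -
    have "finite l" "x \<in> l" using that finite_line[of l] by auto
    then show ?thesis by (rule sum.remove)
  qed
  then have "(\<Sum>l | l \<in> L \<and> x \<in> l. \<Sum>y\<in>l. h y) = (\<Sum>l | l \<in> L \<and> x \<in> l. h x + (\<Sum>y\<in>l - {x}. h y))"
    by (rule sum.cong[OF refl])
  also have "\<dots> = of_nat (n + 1) * h x + (\<Sum>y\<in>P - {x}. h y)"
    by (simp only: sum.distrib pencil_sum_punctured[OF x] sum_constant card_pencil[OF x])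
  also have "\<dots> = of_nat n * h x + (h x + (\<Sum>y\<in>P - {x}. h y))"
    by (simp add: algebra_simps)
  also have "h x + (\<Sum>y\<in>P - {x}. h y) = (\<Sum>y\<in>P. h y)"
    by (rule sum.remove[OF finite_points x, symmetric])
  finally show ?thesis by (simp only: add.commute)
qed

lemma pencil_card:
  assumes "x \<in> P" "X \<subseteq> P"
  shows "(\<Sum>l | l \<in> L \<and> x \<in> l. card (l \<inter> X)) = card X + n * of_bool (x \<in> X)"
proof -
  have *: "(\<Sum>y\<in>Y. of_bool (y \<in> X)) = card (Y \<inter> X)" if "Y \<subseteq> P" for Y
    using finite_subset[OF that finite_points]
    by (simp add: of_bool_def sum.If_cases)
  have "(\<Sum>l | l \<in> L \<and> x \<in> l. card (l \<inter> X)) = (\<Sum>l | l \<in> L \<and> x \<in> l. \<Sum>y\<in>l. of_bool (y \<in> X))"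
    using line_subset by (intro sum.cong refl) (simp add: *)
  also have "\<dots> = card (P \<inter> X) + n * of_bool (x \<in> X)"
    using pencil_sum[OF assms(1), of "\<lambda>y. of_bool (y \<in> X) :: nat"] by (simp add: *)
  finally show ?thesis using assms(2) by (simp add: Int_absorb1)
qed

lemma ex_point: obtains x where "x \<in> P"
proof -
  obtain Q where "Q \<subseteq> P" "card Q = 4" by (rule quadrangle) blast
  then have "Q \<noteq> {}" "Q \<subseteq> P" by auto
  then show ?thesis using that by blast
qed

lemma card_points: "card P = n\<^sup>2 + n + 1"
proof -
  obtain x where x: "x \<in> P" by (rule ex_point)
  have "(\<Sum>l | l \<in> L \<and> x \<in> l. card (l \<inter> P)) = (\<Sum>l | l \<in> L \<and> x \<in> l. n + 1)"
    using card_line line_subset by (intro sum.cong refl) (auto simp: Int_absorb2)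
  then have "(n + 1) * (n + 1) = card P + n"
    using pencil_card[OF x order.refl] x card_pencil[OF x] by simp
  then show ?thesis by (simp add: power2_eq_square)
qed

lemma flag_sum:
  fixes h :: "'a \<Rightarrow> 'a set \<Rightarrow> 'b::comm_monoid_add"
  assumes "X \<subseteq> P"
  shows "(\<Sum>x\<in>X. \<Sum>l | l \<in> L \<and> x \<in> l. h x l) = (\<Sum>l\<in>L. \<Sum>x\<in>l \<inter> X. h x l)"
proof -
  have fin: "finite X" by (rule finite_subset[OF assms finite_points])
  have "(\<Sum>x\<in>X. \<Sum>l | l \<in> L \<and> x \<in> l. h x l) = (\<Sum>l\<in>L. \<Sum>x | x \<in> X \<and> x \<in> l. h x l)"
    by (rule sum.swap_restrict[OF fin finite_lines])
  also have "\<dots> = (\<Sum>l\<in>L. \<Sum>x\<in>l \<inter> X. h x l)"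
    by (intro sum.cong refl) auto
  finally show ?thesis .
qed

lemma card_lines: "card L = n\<^sup>2 + n + 1"
proof -
  have "(\<Sum>x\<in>P. \<Sum>l | l \<in> L \<and> x \<in> l. 1) = (\<Sum>l\<in>L. \<Sum>x\<in>l \<inter> P. (1::nat))"
    by (rule flag_sum) simp
  also have "\<dots> = (\<Sum>l\<in>L. n + 1)"
    using card_line line_subset by (intro sum.cong refl) (auto simp: Int_absorb2)
  finally have "card P * (n + 1) = card L * (n + 1)"
    using card_pencil by simp
  then have "card P = card L" by (simp only: mult_cancel2) simp
  then show ?thesis using card_points by simp
qed

lemma ex_two_lines: obtains l m where "l \<in> L" "m \<in> L" "l \<noteq> m"
proof -
  have "2 \<le> card L" using card_lines n_pos by simp
  then have "\<not> card L \<le> Suc 0" by simp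
  then show ?thesis using that by (auto simp: card_le_Suc0_iff_eq finite_lines)
qed

end

subsection \<open>Excess of lines\<close>

locale dual_word = plane_of_order "p\<^sup>2" P L for p :: nat and P :: "'a set" and L +
  fixes v :: "'a \<Rightarrow> 'r::prime_card mod_ring"
  assumes card_r: "CARD('r) = p" and p_ge_7: "p \<ge> 7" and v_dual: "v \<in> dual_plane_code P L"
begin

definition supp :: "'a set" where "supp = {x. v x \<noteq> 0}"

definition pts :: "'r mod_ring \<Rightarrow> 'a set" where "pts a = {x \<in> P. v x = a}"

definition num :: "'r mod_ring \<Rightarrow> nat" where "num a = card (pts a)"

definition occ :: "'a set \<Rightarrow> 'r mod_ring \<Rightarrow> nat" where "occ l a = card (l \<inter> pts a)"

definition lift_sum :: "'r mod_ring \<Rightarrow> 'a set \<Rightarrow> nat" where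
  "lift_sum a X = (\<Sum>x\<in>X. residue (v x / a))"

text \<open>
  \<open>excess a l\<close> is only meaningful for lines meeting the support: otherwise the lifted sum is 0 and the
  truncated subtraction hides it.
\<close>

definition excess :: "'r mod_ring \<Rightarrow> 'a set \<Rightarrow> nat" where
  "excess a l = lift_sum a l div p - 1"

text \<open>This solves the identity of \<open>lift_sum_points\<close> for the sum of the excesses
  through a point of symbol \<open>a\<close>. No point enters the formula, so independence of its
  choice is built in.\<close>

definition total_excess :: "'r mod_ring \<Rightarrow> nat" where
  "total_excess a = (lift_sum a P + p\<^sup>2) div p - (p\<^sup>2 + 1)"

lemma prime_p: "prime p"
  using prime_card[where 'a='r] card_r by simp

lemma odd_p: "odd p"
  using prime_p p_ge_7 prime_odd_nat by simp

lemma residue_less_p: "residue (x :: 'r mod_ring) < p"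
  using residue_less_card[of x] card_r by simp

lemma of_nat_eq_0_iff: "(of_nat k :: 'r mod_ring) = 0 \<longleftrightarrow> p dvd k"
  using of_nat_mod_ring_eq_0_iff[of k, where 'r='r] card_r by simp

lemma residue_of_nat_less: "k < p \<Longrightarrow> residue (of_nat k :: 'r mod_ring) = k"
  using residue_of_nat[of k, where 'r='r] card_r by simp

lemma numeral_neq_0: "numeral k < p \<Longrightarrow> (numeral k :: 'r mod_ring) \<noteq> 0"
  using of_nat_eq_0_iff[of "numeral k"] by (auto dest: dvd_imp_le)

lemma neq_minus_self:
  assumes "(a :: 'r mod_ring) \<noteq> 0"
  shows "a \<noteq> - a" "- a \<noteq> a"
proof -
  have "a + a \<noteq> 0" using assms numeral_neq_0[of "num.Bit0 num.One"] p_ge_7 by (simp add: mult_2[symmetric])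
  then show "a \<noteq> - a" by (simp only: eq_neg_iff_add_eq_0 not_False_eq_True)
  then show "- a \<noteq> a" by (rule not_sym)
qed

lemma supp_subset: "supp \<subseteq> P"
  using v_dual by (auto simp: dual_plane_code_def point_vectors_def supp_def)

lemma finite_supp: "finite supp"
  by (rule finite_subset[OF supp_subset finite_points])

lemma line_sum_eq_0: "l \<in> L \<Longrightarrow> (\<Sum>x\<in>l. v x) = 0"
  using v_dual by (auto simp: dual_plane_code_def)

lemma pts_subset: "pts a \<subseteq> P"
  by (auto simp: pts_def)

lemma finite_pts: "finite (pts a)"
  by (rule finite_subset[OF pts_subset finite_points])

lemma in_pts_iff: "a \<noteq> 0 \<Longrightarrow> x \<in> pts a \<longleftrightarrow> v x = a"
  using supp_subset by (auto simp: pts_def supp_def)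

lemma num_pos_iff: "num a > 0 \<longleftrightarrow> pts a \<noteq> {}"
  by (simp add: num_def card_gt_0_iff finite_pts)

lemma dvd_lift_sum:
  assumes "l \<in> L"
  shows "p dvd lift_sum a l"
proof -
  have "(of_nat (lift_sum a l) :: 'r mod_ring) = (\<Sum>x\<in>l. v x / a)"
    by (simp add: lift_sum_def)
  also have "\<dots> = 0"
    by (simp only: sum_divide_distrib[symmetric] line_sum_eq_0[OF assms] div_0)
  finally show ?thesis by (simp only: of_nat_eq_0_iff)
qed

lemma lift_sum_eq_excess:
  assumes "l \<in> L" "x \<in> l" "v x \<noteq> 0" "a \<noteq> 0"
  shows "lift_sum a l = p * (1 + excess a l)"
proof -
  have "residue (v x / a) > 0"
    using assms(3,4) by (simp add: zero_less_iff_neq_zero)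
  then have "lift_sum a l > 0"
    unfolding lift_sum_def using assms(1,2) finite_line by (intro sum_pos2[of l x]) auto
  moreover obtain k where "lift_sum a l = p * k" using dvd_lift_sum[OF assms(1)] by (auto simp: dvd_def)
  ultimately show ?thesis using p_ge_7 by (cases k) (auto simp: excess_def)
qed

lemma lift_sum_pencil:
  assumes "x \<in> P"
  shows "(\<Sum>l | l \<in> L \<and> x \<in> l. lift_sum a l) = lift_sum a P + p\<^sup>2 * residue (v x / a)"
  using pencil_sum[OF assms, of "\<lambda>y. residue (v y / a)"] by (simp add: lift_sum_def)

text \<open>Both sides count the lifts over the lines through \<open>x\<close>: line by line each
  contributes a positive multiple of \<open>p\<close>, and point by point \<open>x\<close>, whose
  lift is 1, is counted \<open>p\<^sup>2\<close> extra times.\<close>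

lemma lift_sum_points:
  assumes "x \<in> pts a" "a \<noteq> 0"
  shows "lift_sum a P + p\<^sup>2 = p * (p\<^sup>2 + 1 + (\<Sum>l | l \<in> L \<and> x \<in> l. excess a l))"
proof -
  have x: "x \<in> P" "v x = a" using assms by (auto simp: pts_def)
  have "(\<Sum>l | l \<in> L \<and> x \<in> l. lift_sum a l) = (\<Sum>l | l \<in> L \<and> x \<in> l. p * (1 + excess a l))"
    using lift_sum_eq_excess x assms(2) by (intro sum.cong refl) auto
  also have "\<dots> = p * (p\<^sup>2 + 1 + (\<Sum>l | l \<in> L \<and> x \<in> l. excess a l))"
    using card_pencil[OF x(1)] by (simp add: sum_distrib_left[symmetric] sum.distrib algebra_simps)
  finally show ?thesis using lift_sum_pencil[OF x(1), of a] x(2) assms(2) by simp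
qed

lemma sum_excess:
  assumes "x \<in> pts a" "a \<noteq> 0"
  shows "(\<Sum>l | l \<in> L \<and> x \<in> l. excess a l) = total_excess a"
  using lift_sum_points[OF assms] p_ge_7 by (simp add: total_excess_def)

lemma lift_sum_points_eq:
  assumes "num a > 0" "a \<noteq> 0"
  shows "lift_sum a P + p\<^sup>2 = p * (p\<^sup>2 + 1 + total_excess a)"
proof -
  obtain x where "x \<in> pts a" using assms num_pos_iff by auto
  then show ?thesis using lift_sum_points sum_excess assms(2) by simp
qed

lemma excess_le_total:
  assumes "l \<in> L" "x \<in> l" "x \<in> pts a" "a \<noteq> 0"
  shows "excess a l \<le> total_excess a"
proof -
  have "x \<in> P" using assms by (auto simp: pts_def)
  then show ?thesis
    unfolding sum_excess[OF assms(3,4), symmetric]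
    using assms finite_pencil by (intro member_le_sum) auto
qed

text \<open>The lifts of a nonzero value relative to \<open>a\<close> and to \<open>- a\<close> are
  complementary and add up to \<open>p\<close>.\<close>

lemma lift_sum_add_minus:
  assumes "X \<subseteq> P" "a \<noteq> 0"
  shows "lift_sum a X + lift_sum (- a) X = p * card (X \<inter> supp)"
proof -
  have fin: "finite X" by (rule finite_subset[OF assms(1) finite_points])
  have "lift_sum a X + lift_sum (- a) X = (\<Sum>x\<in>X. residue (v x / a) + residue (- (v x / a)))"
    by (simp add: lift_sum_def sum.distrib)
  also have "\<dots> = (\<Sum>x\<in>X. p * of_bool (x \<in> supp))"
  proof (intro sum.cong refl)
    fix x
    show "residue (v x / a) + residue (- (v x / a)) = p * of_bool (x \<in> supp)"
      using residue_add_residue_minus[of "v x / a"] assms(2) card_r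
      by (cases "v x = 0") (auto simp: supp_def)
  qed
  also have "\<dots> = p * card (X \<inter> supp)"
    using fin by (simp add: sum_distrib_left[symmetric] of_bool_def sum.If_cases)
  finally show ?thesis .
qed

lemma lift_sum_Int_supp: "finite X \<Longrightarrow> lift_sum a X = lift_sum a (X \<inter> supp)"
  unfolding lift_sum_def by (rule sum.mono_neutral_right) (auto simp: supp_def)

text \<open>One support point has lift 1 and the others at most \<open>p - 1\<close>, so
  \<open>k\<close> support points and excess \<open>e\<close> give
  \<open>p * (1 + e) \<le> 1 + (k - 1) * (p - 1)\<close>. This means \<open>e \<le> k - 3\<close>,
  except on a line with two support points, where \<open>e = 0\<close>.\<close>

lemma excess_add_3_le:
  assumes "l \<in> L" "x \<in> l" "x \<in> pts a" "a \<noteq> 0"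
  shows "excess a l + 3 \<le> card (l \<inter> supp) + of_bool (card (l \<inter> supp) = 2)"
proof -
  let ?k = "card (l \<inter> supp)"
  have vx: "v x = a" using assms by (simp add: in_pts_iff)
  have fin: "finite (l \<inter> supp)" using finite_supp by simp
  have xin: "x \<in> l \<inter> supp" using assms vx by (simp add: supp_def)
  have kpos: "?k \<ge> 1" using fin xin by (metis One_nat_def Suc_leI card_gt_0_iff empty_iff)
  have "lift_sum a l = residue (v x / a) + (\<Sum>y\<in>l \<inter> supp - {x}. residue (v y / a))"
    using lift_sum_Int_supp[OF finite_line[OF assms(1)], of a] sum.remove[OF fin xin, of "\<lambda>y. residue (v y / a)"]
    by (simp add: lift_sum_def)
  also have "(\<Sum>y\<in>l \<inter> supp - {x}. residue (v y / a)) \<le> (\<Sum>y\<in>l \<inter> supp - {x}. p - 1)"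
  proof (rule sum_mono)
    fix y show "residue (v y / a) \<le> p - 1"
      using residue_less_p[of "v y / a"] by linarith
  qed
  also have "\<dots> = (?k - 1) * (p - 1)" using xin fin by (simp add: card_Diff_singleton)
  finally have le: "lift_sum a l \<le> 1 + (?k - 1) * (p - 1)" using vx assms(4) by simp
  define e where "e = excess a l"
  have eq: "lift_sum a l = p * (1 + e)"
    using lift_sum_eq_excess[of l x a] assms vx unfolding e_def by simp
  obtain k where k: "?k = k + 1" using kpos by (metis add.commute le_Suc_ex)
  define r where "r = p - 1"
  have r: "p = r + 1" "r \<ge> 6" using p_ge_7 by (auto simp: r_def)
  have ineq: "(r + 1) * (1 + e) \<le> 1 + k * r" using le unfolding eq k r by simp
  have "e < k"
  proof (rule ccontr)
    assume "\<not> e < k"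
    then have "k * r \<le> e * r" by (intro mult_right_mono) auto
    moreover have "(r + 1) * (1 + e) = r + 1 + e + e * r" by (simp add: algebra_simps)
    ultimately show False using ineq r by linarith
  qed
  moreover have "k = 1 \<Longrightarrow> e = 0" using \<open>e < k\<close> by simp
  \<comment> \<open>Here \<open>k\<close> is one less than the number of support points;
    \<open>e = k - 1\<close> would give \<open>(r + 1) * k \<le> 1 + k * r\<close>, that is
    \<open>k \<le> 1\<close>.\<close>
  moreover have "e + 2 \<le> k" if "k \<ge> 2"
  proof (rule ccontr)
    assume "\<not> e + 2 \<le> k"
    then have "e = k - 1" using \<open>e < k\<close> by simp
    then show False using ineq r that by (cases k) (auto simp: algebra_simps)
  qed
  ultimately show "excess a l + 3 \<le> card (l \<inter> supp) + of_bool (card (l \<inter> supp) = 2)"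
    unfolding e_def[symmetric] k by (cases "k = 1"; force)
qed

lemma sum_occ_pencil:
  assumes "x \<in> P"
  shows "(\<Sum>l | l \<in> L \<and> x \<in> l. occ l a) = num a + p\<^sup>2 * of_bool (v x = a)"
  using pencil_card[OF assms pts_subset, of a] assms by (simp add: occ_def num_def pts_def)

text \<open>The two values on such a line sum to 0. The exceptional term of
  \<open>excess_add_3_le\<close> can thus be paid for by a point of symbol
  \<open>- a\<close>.\<close>

lemma neg_on_two_secant:
  assumes "l \<in> L" "x \<in> l" "x \<in> pts a" "a \<noteq> 0" "card (l \<inter> supp) = 2"
  shows "1 \<le> occ l (- a)"
proof -
  have vx: "v x = a" using assms by (simp add: in_pts_iff)
  have xin: "x \<in> l \<inter> supp" using assms vx by (simp add: supp_def)
  obtain y where y: "l \<inter> supp = {x, y}" "x \<noteq> y"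
  proof -
    obtain s t where st: "l \<inter> supp = {s, t}" "s \<noteq> t" using assms(5) unfolding card_2_iff by blast
    show ?thesis
    proof (cases "x = s")
      case True
      then show ?thesis using that[of t] st by auto
    next
      case False
      then have "x = t" using xin st by auto
      then show ?thesis using that[of s] st by auto
    qed
  qed
  have "0 = (\<Sum>z\<in>l. v z)" using line_sum_eq_0[OF assms(1)] by simp
  also have "\<dots> = (\<Sum>z\<in>l \<inter> supp. v z)"
    using finite_line[OF assms(1)] by (intro sum.mono_neutral_right) (auto simp: supp_def)
  also have "\<dots> = a + v y" using y vx by simp
  finally have "v y = - a" by (simp add: eq_neg_iff_add_eq_0 add.commute)
  then have "y \<in> l \<inter> pts (- a)" using y assms(4) by (auto simp: in_pts_iff)
  then have "card (l \<inter> pts (- a)) > 0" by (subst card_gt_0_iff) (auto simp: finite_pts)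
  then show ?thesis by (simp add: occ_def)
qed

lemma excess_add_3_le_occ:
  assumes "l \<in> L" "x \<in> l" "x \<in> pts a" "a \<noteq> 0"
  shows "excess a l + 3 \<le> card (l \<inter> supp) + occ l (- a)"
  using excess_add_3_le[OF assms] neg_on_two_secant[OF assms]
  by (cases "card (l \<inter> supp) = 2") auto

lemma sum_card_add_occ:
  assumes "x \<in> pts a" "a \<noteq> 0"
  shows "(\<Sum>l | l \<in> L \<and> x \<in> l. card (l \<inter> supp) + occ l (- a)) = card supp + p\<^sup>2 + num (- a)"
proof -
  have x: "x \<in> P" "v x = a" "x \<in> supp" using assms by (auto simp: pts_def supp_def)
  then show ?thesis
    using pencil_card[OF x(1) supp_subset] sum_occ_pencil[OF x(1), of "- a"] neq_minus_self[OF assms(2)]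
    by (simp add: sum.distrib)
qed

lemma sum_excess_add_3:
  assumes "x \<in> pts a" "a \<noteq> 0"
  shows "(\<Sum>l | l \<in> L \<and> x \<in> l. excess a l + 3) = total_excess a + 3 * (p\<^sup>2 + 1)"
  using card_pencil[of x] sum_excess[OF assms] assms(1) by (simp add: sum.distrib pts_def)

text \<open>This is \<open>excess_add_3_le_occ\<close> summed over the \<open>p\<^sup>2 + 1\<close>
  lines through \<open>x\<close>.\<close>

lemma num_neg_lower_bound:
  assumes "x \<in> pts a" "a \<noteq> 0"
  shows "2 * p\<^sup>2 + 3 + total_excess a \<le> card supp + num (- a)"
proof -
  have "(\<Sum>l | l \<in> L \<and> x \<in> l. excess a l + 3) \<le> (\<Sum>l | l \<in> L \<and> x \<in> l. card (l \<inter> supp) + occ l (- a))"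
    using excess_add_3_le_occ[OF _ _ assms] by (intro sum_mono) simp
  then show ?thesis
    unfolding sum_card_add_occ[OF assms] sum_excess_add_3[OF assms] by simp
qed

text \<open>If the summed bound is attained, so is the bound on every line of the pencil. This pins
  down the long lines when all symbols occur.\<close>

lemma excess_add_3_eq_occ:
  assumes "l \<in> L" "x \<in> l" "x \<in> pts a" "a \<noteq> 0"
    and tight: "2 * p\<^sup>2 + 3 + total_excess a = card supp + num (- a)"
  shows "excess a l + 3 = card (l \<inter> supp) + occ l (- a)"
proof (rule sum_mono_inv[where I = "{l \<in> L. x \<in> l}"])
  show "(\<Sum>l | l \<in> L \<and> x \<in> l. excess a l + 3) = (\<Sum>l | l \<in> L \<and> x \<in> l. card (l \<inter> supp) + occ l (- a))"
    unfolding sum_card_add_occ[OF assms(3,4)] sum_excess_add_3[OF assms(3,4)] using tight by simp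
  show "finite {l \<in> L. x \<in> l}" using assms(3) by (intro finite_pencil) (simp add: pts_def)
qed (use assms excess_add_3_le_occ in auto)

end

section \<open>Words of weight at most \<open>2 * p\<^sup>2 - 2 * p + 4\<close>\<close>

locale light_word = dual_word p P L v
  for p :: nat and P :: "'a set" and L and v :: "'a \<Rightarrow> 'r::prime_card mod_ring" +
  assumes light: "card supp + 2 * p \<le> 2 * p\<^sup>2 + 4"
begin

text \<open>By \<open>num_neg_lower_bound\<close> and the weight bound, \<open>- a\<close> occurs at
  least \<open>2 * p - 1\<close> times.\<close>

lemma num_neg_pos:
  assumes "num a > 0" "a \<noteq> 0"
  shows "num (- a) > 0"
proof -
  obtain x where "x \<in> pts a" using assms num_pos_iff by auto
  then show ?thesis using num_neg_lower_bound[of x a] light assms(2) p_ge_7 by linarith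
qed

text \<open>The lifted sums over \<open>P\<close> relative to \<open>a\<close> and
  \<open>- a\<close> add up to \<open>p * card supp\<close>, while \<open>lift_sum_points_eq\<close>
  evaluates each of them. The lower bound on the weight is a consequence.\<close>

lemma card_supp_eq:
  assumes "num a > 0" "a \<noteq> 0"
  shows "card supp + 2 * p = 2 * p\<^sup>2 + 2 + total_excess a + total_excess (- a)"
proof -
  have "lift_sum a P + lift_sum (- a) P = p * card supp"
    using lift_sum_add_minus[OF order.refl, of a] assms(2) supp_subset
    by (simp add: Int_absorb1)
  then have "p * card supp + 2 * p\<^sup>2 = p * (p\<^sup>2 + 1 + total_excess a) + p * (p\<^sup>2 + 1 + total_excess (- a))"
    using lift_sum_points_eq[OF assms] lift_sum_points_eq[OF num_neg_pos[OF assms]] assms(2) by simp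
  then have "p * (card supp + 2 * p) = p * (2 * p\<^sup>2 + 2 + total_excess a + total_excess (- a))"
    by (simp add: algebra_simps power2_eq_square)
  then show ?thesis using p_ge_7 by (simp only: mult_cancel1) simp
qed

text \<open>As soon as a nonzero symbol occurs, \<open>card_supp_eq\<close> shows that the truncated
  subtraction is exact; \<open>card_supp_eps\<close> records this.\<close>

definition eps :: nat where "eps = card supp + 2 * p - 2 * p\<^sup>2 - 2"

lemma eps_le_2: "eps \<le> 2"
  using light by (simp add: eps_def)

lemma total_excess_add:
  assumes "num a > 0" "a \<noteq> 0"
  shows "total_excess a + total_excess (- a) = eps"
  using card_supp_eq[OF assms] by (simp add: eps_def)

lemma card_supp_eps:
  assumes "num a > 0" "a \<noteq> 0"
  shows "card supp + 2 * p = 2 * p\<^sup>2 + 2 + eps"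
  using card_supp_eq[OF assms] total_excess_add[OF assms] by simp

text \<open>Apply \<open>num_neg_lower_bound\<close> at a point of symbol \<open>- a\<close> and
  insert the exact weight; the terms \<open>total_excess (- a)\<close> cancel.\<close>

lemma num_lower_bound:
  assumes "num a > 0" "a \<noteq> 0"
  shows "2 * p + 1 \<le> num a + total_excess a"
proof -
  obtain x where "x \<in> pts (- a)" using num_neg_pos[OF assms] num_pos_iff by auto
  then show ?thesis
    using num_neg_lower_bound[of x "- a"] assms(2) card_supp_eq[OF assms] by simp
qed

end

subsection \<open>The set of symbols has no gaps\<close>

context dual_word
begin

lemma of_nat_residue_mult: "a \<noteq> 0 \<Longrightarrow> of_nat (residue (b / a)) * a = (b :: 'r mod_ring)"
  by simp

lemma residue_of_nat_mult_div:
  "(a :: 'r mod_ring) \<noteq> 0 \<Longrightarrow> k < p \<Longrightarrow> residue (of_nat k * a / a) = k"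
  by (simp add: residue_of_nat_less)

lemma of_nat_diff_mult: "k \<le> p \<Longrightarrow> of_nat (p - k) * (a :: 'r mod_ring) = - (of_nat k * a)"
  using of_nat_eq_0_iff[of p] by (simp add: of_nat_diff)

lemma sum_by_residue:
  fixes G :: "nat \<Rightarrow> nat"
  assumes "a \<noteq> 0" "G 0 = 0"
  shows "(\<Sum>y\<in>P. G (residue (v y / a))) = (\<Sum>i=1..<p. num (of_nat i * a) * G i)"
proof -
  have "(\<Sum>y\<in>P. G (residue (v y / a))) = (\<Sum>i=0..<p. \<Sum>y | y \<in> P \<and> residue (v y / a) = i. G (residue (v y / a)))"
    using finite_points residue_less_p by (intro sum.group[symmetric]) auto
  also have "\<dots> = (\<Sum>i=0..<p. num (of_nat i * a) * G i)"
  proof (intro sum.cong refl)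
    fix i assume i: "i \<in> {0..<p}"
    have "{y \<in> P. residue (v y / a) = i} = pts (of_nat i * a)"
      using assms(1) residue_of_nat_mult_div[OF assms(1), of i] of_nat_residue_mult[OF assms(1)] i
      by (auto simp: pts_def)
    moreover have "(\<Sum>y | y \<in> P \<and> residue (v y / a) = i. G (residue (v y / a))) =
        (\<Sum>y | y \<in> P \<and> residue (v y / a) = i. G i)"
      by (intro sum.cong) auto
    ultimately show "(\<Sum>y | y \<in> P \<and> residue (v y / a) = i. G (residue (v y / a))) = num (of_nat i * a) * G i"
      by (simp add: num_def)
  qed
  also have "\<dots> = (\<Sum>i=1..<p. num (of_nat i * a) * G i)"
    using assms(2) p_ge_7 by (simp add: sum.atLeast_Suc_lessThan)
  finally show ?thesis .
qed

text \<open>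
  On a line of excess 0 there is at most one lift \<open>p - i\<close> with \<open>2 \<le> i \<le> t + 1\<close>, and the remaining lifts sum to
  \<open>i - 1 > 0\<close>. If \<open>i = t + 1\<close> and \<open>t a\<close> is not a symbol, at least two further points are needed, which is the
  purpose of the weight \<open>\<kappa>\<close>.
\<close>

lemma line_large_residues:
  fixes t \<kappa> :: nat
  assumes l: "l \<in> L" "x \<in> l" "x \<in> pts a" "a \<noteq> 0"
    and t: "1 \<le> t" "2 * (t + 1) < p" and \<kappa>: "\<kappa> \<le> 1 \<or> \<kappa> = 2 \<and> num (of_nat t * a) = 0"
  defines "H \<equiv> \<lambda>i. if 2 \<le> i \<and> i \<le> t then 1 else if i = t + 1 then \<kappa> else 0"
  shows "(\<Sum>y\<in>l. H (p - residue (v y / a))) + 1 \<le>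
    (\<Sum>y\<in>l. of_bool (1 \<le> residue (v y / a) \<and> residue (v y / a) \<le> t)) + 6 * excess a l"
proof -
  define u where "u y = residue (v y / a)" for y
  define S where "S = (\<Sum>y\<in>l. of_bool (1 \<le> u y \<and> u y \<le> t) :: nat)"
  define j where "j = excess a l"
  have fin: "finite l" by (rule finite_line[OF l(1)])
  have vx: "v x = a" using l by (simp add: in_pts_iff)
  have ux: "u x = 1" using vx l(4) by (simp add: u_def)
  have H2: "H i \<le> 2" for i using \<kappa> by (auto simp: H_def)
  \<comment> \<open>The lifts on \<open>B\<close> have the form \<open>p - i\<close> with
    \<open>i \<le> t + 1\<close>, so they exceed \<open>p / 2\<close>, and the total
    \<open>p * (1 + j)\<close> leaves room for fewer than \<open>2 * (1 + j)\<close> of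
    them.\<close>
  define B where "B = {y \<in> l. H (p - u y) \<noteq> 0}"
  have B: "finite B" "B \<subseteq> l" "x \<notin> B" using fin ux t by (auto simp: B_def H_def)
  have ub: "p + 1 \<le> 2 * u y" if "y \<in> B" for y
    using that t by (auto simp: B_def H_def split: if_splits)
  have T: "(\<Sum>y\<in>l. u y) = p * (1 + j)"
    using lift_sum_eq_excess[of l x a] l vx by (simp add: lift_sum_def u_def j_def)
  have SB: "(\<Sum>y\<in>l. H (p - u y)) = (\<Sum>y\<in>B. H (p - u y))"
    using fin by (intro sum.mono_neutral_right) (auto simp: B_def)
  have "1 + (\<Sum>y\<in>B. u y) = (\<Sum>y\<in>insert x B. u y)" using B ux by simp
  also have "\<dots> \<le> (\<Sum>y\<in>l. u y)" using B l(2) fin by (intro sum_mono2) auto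
  finally have "1 + (\<Sum>y\<in>B. u y) \<le> p * (1 + j)" using T by simp
  moreover have "card B * (p + 1) \<le> (\<Sum>y\<in>B. 2 * u y)"
    using sum_mono[of B "\<lambda>_. p + 1" "\<lambda>y. 2 * u y"] ub by simp
  moreover have "(\<Sum>y\<in>B. 2 * u y) = 2 * (\<Sum>y\<in>B. u y)" by (simp add: sum_distrib_left)
  moreover have "2 * (1 + j) * (p + 1) = 2 * (p * (1 + j)) + 2 * (1 + j)" by (simp add: algebra_simps)
  ultimately have "card B * (p + 1) < 2 * (1 + j) * (p + 1)" by linarith
  then have cB: "card B < 2 * (1 + j)" by (simp only: mult_less_cancel2)
  have S1: "1 \<le> S"
    unfolding S_def using fin l(2) ux t by (intro order.trans[OF _ member_le_sum[of x l]]) auto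
  have "(\<Sum>y\<in>l. H (p - u y)) + 1 \<le> S + 6 * j"
  proof (cases "j = 0")
    case False
    \<comment> \<open>For positive excess a crude bound suffices: at most \<open>2 * j + 1\<close>
      points of weight at most 2 give \<open>4 * j + 2 \<le> 6 * j\<close>, which is where the
      factor 6 comes from.\<close>
    have "(\<Sum>y\<in>B. H (p - u y)) \<le> card B * 2"
      using sum_mono[of B "\<lambda>y. H (p - u y)" "\<lambda>_. 2"] H2 by simp
    moreover have "1 \<le> j" "card B \<le> 2 * j + 1" using False cB by simp_all
    ultimately show ?thesis using SB cB S1 by linarith
  next
    case True
    show ?thesis
    proof (cases "B = {}")
      case True
      then show ?thesis using SB S1 by simp
    next
      case False
      then have "card B = 1" using cB \<open>j = 0\<close> B(1) card_gt_0_iff[of B] by simp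
      then obtain y where y: "B = {y}" by (auto simp: card_1_singleton_iff)
      define i where "i = p - u y"
      have yl: "y \<in> l" "y \<noteq> x" and Hy: "H i \<noteq> 0" using y B by (auto simp: B_def i_def)
      have i: "2 \<le> i" "i \<le> t + 1" using Hy t by (auto simp: H_def split: if_splits)
      have uy: "u y = p - i" using i(1) unfolding i_def by auto
      define Z where "Z = {z \<in> l - {x, y}. u z \<noteq> 0}"
      have finZ: "finite Z" using fin by (simp add: Z_def)
      have "(\<Sum>z\<in>l. u z) = u x + (u y + (\<Sum>z\<in>l - {x, y}. u z))"
      proof -
        have "(\<Sum>z\<in>l. u z) = u x + (\<Sum>z\<in>l - {x}. u z)" using fin l(2) by (rule sum.remove)
        also have "(\<Sum>z\<in>l - {x}. u z) = u y + (\<Sum>z\<in>l - {x} - {y}. u z)"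
          using fin yl by (intro sum.remove) auto
        also have "l - {x} - {y} = l - {x, y}" by auto
        finally show ?thesis .
      qed
      also have "(\<Sum>z\<in>l - {x, y}. u z) = (\<Sum>z\<in>Z. u z)"
        using fin by (intro sum.mono_neutral_right) (auto simp: Z_def)
      finally have sZ: "(\<Sum>z\<in>Z. u z) = i - 1"
        using T \<open>j = 0\<close> ux uy i t by simp
      have uZ: "u z \<le> i - 1" if "z \<in> Z" for z
        using member_le_sum[of z Z u] that finZ sZ by simp
      have "1 + card Z = card (insert x Z)" using finZ by (simp add: Z_def)
      also have "\<dots> = (\<Sum>z\<in>insert x Z. of_bool (1 \<le> u z \<and> u z \<le> t))"
      proof -
        have "of_bool (1 \<le> u z \<and> u z \<le> t) = (1::nat)" if "z \<in> insert x Z" for z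
        proof (cases "z = x")
          case True
          then show ?thesis using ux t by simp
        next
          case False
          then have "z \<in> Z" using that by simp
          then have "u z \<noteq> 0" "u z \<le> i - 1" using uZ by (auto simp: Z_def)
          then show ?thesis using i by simp
        qed
        then show ?thesis by simp
      qed
      also have "\<dots> \<le> S"
        unfolding S_def using fin l(2) by (intro sum_mono2) (auto simp: Z_def)
      finally have cZ: "1 + card Z \<le> S" .
      have "H i \<le> card Z"
      proof (rule ccontr)
        assume less: "\<not> H i \<le> card Z"
        have "card Z \<noteq> 0"
        proof
          assume "card Z = 0"
          then have "Z = {}" using finZ by simp
          then show False using sZ i by simp
        qed
        then have Hi: "H i = 2" "card Z = 1" using less H2[of i] by linarith+
        then have i': "i = t + 1" "num (of_nat t * a) = 0" using \<kappa> by (auto simp: H_def split: if_splits)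
        obtain z where "Z = {z}" using Hi by (auto simp: card_1_singleton_iff)
        then have "u z = t" "z \<in> l" using sZ i' by (auto simp: Z_def)
        then have "v z = of_nat t * a" using of_nat_residue_mult[OF l(4), of "v z"] by (simp add: u_def)
        then have "z \<in> pts (of_nat t * a)" using \<open>z \<in> l\<close> line_subset[OF l(1)] by (auto simp: pts_def)
        then show False using i'(2) num_pos_iff[of "of_nat t * a"] by auto
      qed
      then show ?thesis using cZ SB y by (simp add: i_def)
    qed
  qed
  then show ?thesis by (simp add: S_def u_def j_def)
qed

text \<open>This sums \<open>line_large_residues\<close> over the pencil of \<open>x\<close> and
  regroups the points by symbol; the lift \<open>p - i\<close> belongs to the symbol
  \<open>- (of_nat i * a)\<close>.\<close>

lemma num_prefix_bound:
  fixes t \<kappa> :: nat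
  assumes x: "x \<in> pts a" "a \<noteq> 0"
    and t: "1 \<le> t" "2 * (t + 1) < p" and \<kappa>: "\<kappa> \<le> 1 \<or> \<kappa> = 2 \<and> num (of_nat t * a) = 0"
  shows "(\<Sum>i=2..t. num (- (of_nat i * a))) + \<kappa> * num (- (of_nat (t + 1) * a)) + 1
    \<le> (\<Sum>i=1..t. num (of_nat i * a)) + 6 * total_excess a"
proof -
  define H where "H i = (if 2 \<le> i \<and> i \<le> t then 1 else if i = t + 1 then \<kappa> else 0)" for i
  define G where "G i = H (p - i)" for i
  define s where "s i = (of_bool (1 \<le> i \<and> i \<le> t) :: nat)" for i
  have xP: "x \<in> P" and vx: "v x = a" using x by (auto simp: pts_def)
  have "(\<Sum>l | l \<in> L \<and> x \<in> l. \<Sum>y\<in>l. G (residue (v y / a))) + (\<Sum>l | l \<in> L \<and> x \<in> l. 1) \<le>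
        (\<Sum>l | l \<in> L \<and> x \<in> l. \<Sum>y\<in>l. s (residue (v y / a))) + (\<Sum>l | l \<in> L \<and> x \<in> l. 6 * excess a l)"
    unfolding sum.distrib[symmetric]
    using line_large_residues[OF _ _ x t \<kappa>] unfolding G_def H_def s_def by (intro sum_mono) simp
  \<comment> \<open>The point \<open>x\<close> itself is counted \<open>p\<^sup>2\<close> extra
    times on the right only. This cancels all but one of the \<open>p\<^sup>2 + 1\<close> ones on
    the left.\<close>
  moreover have "G 1 = 0" "s 1 = 1" using t by (auto simp: G_def H_def s_def)
  ultimately have main: "(\<Sum>y\<in>P. G (residue (v y / a))) + 1 \<le> (\<Sum>y\<in>P. s (residue (v y / a))) + 6 * total_excess a"
    using pencil_sum[OF xP, of "\<lambda>y. G (residue (v y / a))"]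
      pencil_sum[OF xP, of "\<lambda>y. s (residue (v y / a))"]
      card_pencil[OF xP] sum_excess[OF x] vx x(2)
    by (simp add: sum_distrib_left[symmetric])
  have "(\<Sum>y\<in>P. s (residue (v y / a))) = (\<Sum>i=1..<p. num (of_nat i * a) * s i)"
    by (rule sum_by_residue[OF x(2)]) (simp add: s_def)
  also have "\<dots> = (\<Sum>i=1..t. num (of_nat i * a) * s i)"
    using t by (intro sum.mono_neutral_right) (auto simp: s_def)
  also have "\<dots> = (\<Sum>i=1..t. num (of_nat i * a))"
    by (intro sum.cong) (auto simp: s_def)
  finally have s: "(\<Sum>y\<in>P. s (residue (v y / a))) = (\<Sum>i=1..t. num (of_nat i * a))" .
  have "(\<Sum>y\<in>P. G (residue (v y / a))) = (\<Sum>i=1..<p. num (of_nat i * a) * G i)"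
    using t by (intro sum_by_residue[OF x(2)]) (simp add: G_def H_def)
  also have "\<dots> = (\<Sum>i=1..<p. num (of_nat (p - i) * a) * G (p - i))"
    by (rule sum.reindex_bij_witness[of _ "\<lambda>i. p - i" "\<lambda>i. p - i"]) auto
  also have "\<dots> = (\<Sum>i=1..<p. num (- (of_nat i * a)) * H i)"
    by (intro sum.cong refl) (simp add: of_nat_diff_mult G_def del: of_nat_diff)
  also have "\<dots> = (\<Sum>i\<in>insert (t + 1) {2..t}. num (- (of_nat i * a)) * H i)"
    using t by (intro sum.mono_neutral_right) (auto simp: H_def)
  also have "\<dots> = num (- (of_nat (t + 1) * a)) * \<kappa> + (\<Sum>i=2..t. num (- (of_nat i * a)))"
    using t by (simp add: H_def)
  finally show ?thesis using main s by (simp add: mult.commute)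
qed

end

context light_word
begin

definition pair_num :: "'r mod_ring \<Rightarrow> nat" where "pair_num a = num a + num (- a)"

lemma pair_num_minus [simp]: "pair_num (- a) = pair_num a"
  by (simp add: pair_num_def)

lemma pair_num_lower_bound:
  assumes "num a > 0" "a \<noteq> 0"
  shows "4 * p + 2 \<le> pair_num a + eps"
  using num_lower_bound[OF assms] num_lower_bound[OF num_neg_pos[OF assms]] total_excess_add[OF assms] assms(2)
  by (simp add: pair_num_def)

lemma num_eq_0_minus: "a \<noteq> 0 \<Longrightarrow> num a = 0 \<Longrightarrow> num (- a) = 0"
  using num_neg_pos[of "- a"] by auto

text \<open>
  The prefix sums for \<open>a\<close> and for \<open>-a\<close> telescope against each other when the two bounds are added.
\<close>

lemma pair_num_step:
  assumes a: "num a > 0" "a \<noteq> 0" and t: "1 \<le> t" "2 * (t + 1) < p"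
    and \<kappa>: "\<kappa> \<le> 1 \<or> \<kappa> = 2 \<and> num (of_nat t * a) = 0"
  shows "\<kappa> * pair_num (of_nat (t + 1) * a) \<le> pair_num a + 10"
proof -
  obtain x where x: "x \<in> pts a" using a num_pos_iff by auto
  obtain y where y: "y \<in> pts (- a)" using num_neg_pos[OF a] num_pos_iff by auto
  have "of_nat t * a \<noteq> 0"
    using a(2) t of_nat_eq_0_iff[of t] by (auto dest: dvd_imp_le)
  then have \<kappa>': "\<kappa> \<le> 1 \<or> \<kappa> = 2 \<and> num (of_nat t * (- a)) = 0"
    using \<kappa> num_eq_0_minus[of "of_nat t * a"] by auto
  have split: "(\<Sum>i=1..t. f i) = f 1 + (\<Sum>i=2..t. f i)" for f :: "nat \<Rightarrow> nat"
    using t(1) by (simp add: sum.atLeast_Suc_atMost numeral_2_eq_2)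
  have "(\<Sum>i=2..t. num (- (of_nat i * a))) + \<kappa> * num (- (of_nat (t + 1) * a)) + 1
    \<le> (\<Sum>i=1..t. num (of_nat i * a)) + 6 * total_excess a"
    by (rule num_prefix_bound[OF x a(2) t \<kappa>])
  moreover have "(\<Sum>i=2..t. num (of_nat i * a)) + \<kappa> * num (of_nat (t + 1) * a) + 1
    \<le> (\<Sum>i=1..t. num (- (of_nat i * a))) + 6 * total_excess (- a)"
    using num_prefix_bound[OF y _ t \<kappa>'] a(2) by (simp del: of_nat_Suc of_nat_add)
  moreover have "(\<Sum>i=1..t. num (of_nat i * a)) = num a + (\<Sum>i=2..t. num (of_nat i * a))"
    "(\<Sum>i=1..t. num (- (of_nat i * a))) = num (- a) + (\<Sum>i=2..t. num (- (of_nat i * a)))"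
    using split[of "\<lambda>i. num (of_nat i * a)"] split[of "\<lambda>i. num (- (of_nat i * a))"] by simp_all
  \<comment> \<open>The additive constant arises as \<open>6 * eps - 2 \<le> 10\<close>.\<close>
  ultimately show ?thesis
    using total_excess_add[OF a] eps_le_2
    unfolding pair_num_def distrib_left by linarith
qed

text \<open>The residues of \<open>b / a\<close> and \<open>- b / a\<close> add up to the odd number
  \<open>p\<close>, so one of them is below \<open>p / 2\<close>, the range in which
  \<open>pair_num_step\<close> works.\<close>

lemma small_multiple:
  assumes "a \<noteq> 0" "(b :: 'r mod_ring) \<noteq> 0"
  obtains k where "1 \<le> k" "2 * k < p" "b = of_nat k * a \<or> b = - (of_nat k * a)"
proof -
  define r where "r = residue (b / a)"
  have r: "r < p" "r \<noteq> 0" "b = of_nat r * a"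
    using residue_less_p[of "b / a"] assms by (auto simp: r_def)
  show ?thesis
  proof (cases "2 * r < p")
    case True
    then show ?thesis using that[of r] r by simp
  next
    case False
    have "2 * r \<noteq> p" using odd_p by (metis dvd_triv_left)
    then have "2 * (p - r) < p" using False r by linarith
    then show ?thesis using that[of "p - r"] r of_nat_diff_mult[of r a] by auto
  qed
qed

text \<open>Up to sign, which \<open>pair_num\<close> ignores, \<open>b\<close> is a small multiple
  of \<open>a\<close>; the step with weight 1 then applies.\<close>

lemma pair_num_close:
  assumes a: "num a > 0" "a \<noteq> 0" and b: "b \<noteq> 0"
  shows "pair_num b \<le> pair_num a + 10"
proof -
  obtain k where k: "1 \<le> k" "2 * k < p" "b = of_nat k * a \<or> b = - (of_nat k * a)"
    by (rule small_multiple[OF a(2) b])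
  have "pair_num (of_nat k * a) \<le> pair_num a + 10"
  proof (cases "k = 1")
    case False
    then show ?thesis using pair_num_step[OF a, of "k - 1" 1] k by simp
  qed simp
  then show ?thesis using k(3) by auto
qed

text \<open>If the multiple \<open>t\<close> of \<open>a\<close> were missing, weight 2 would be
  allowed in \<open>pair_num_step\<close>. With \<open>pair_num_close\<close> this bounds
  \<open>pair_num\<close> of the next multiple by 20, although it is at least
  \<open>4 * p + 2 - eps \<ge> 28\<close>.\<close>

lemma num_multiple_pred:
  assumes a: "num a > 0" "a \<noteq> 0" and t: "1 \<le> t" "2 * (t + 1) < p"
    and pos: "num (of_nat (t + 1) * a) > 0"
  shows "num (of_nat t * a) > 0"
proof (rule ccontr)
  assume "\<not> num (of_nat t * a) > 0"
  then have "2 * pair_num (of_nat (t + 1) * a) \<le> pair_num a + 10"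
    using pair_num_step[OF a t, of 2] by simp
  moreover have nz: "of_nat (t + 1) * a \<noteq> 0"
    using a(2) t of_nat_eq_0_iff[of "t + 1"] by (auto dest: dvd_imp_le)
  moreover have "pair_num a \<le> pair_num (of_nat (t + 1) * a) + 10"
    by (rule pair_num_close[OF pos nz a(2)])
  ultimately show False
    using pair_num_lower_bound[OF pos nz] eps_le_2 p_ge_7 by linarith
qed

lemma num_multiple_downward:
  assumes a: "num a > 0" "a \<noteq> 0" and k: "2 * k < p" "num (of_nat k * a) > 0" and i: "1 \<le> i" "i \<le> k"
  shows "num (of_nat i * a) > 0"
  using i(2)
proof (induction rule: inc_induct)
  case base
  show ?case by (rule k(2))
next
  case (step n)
  then show ?case using num_multiple_pred[OF a, of n] i k by simp
qed

text \<open>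
  The multiple \<open>(p - 1) / 2\<close> of the symbol \<open>2 a\<close> is \<open>-a\<close>, so downward closure reaches all multiples of \<open>2 a\<close>.
\<close>

lemma all_symbols_of_three:
  assumes a: "num a > 0" "a \<noteq> 0" and b: "num b > 0" "b \<noteq> 0" "b \<noteq> a" "b \<noteq> - a" and c: "c \<noteq> 0"
  shows "num c > 0"
proof -
  \<comment> \<open>Up to sign the third symbol \<open>b\<close> is a small multiple
    \<open>k * a\<close> with \<open>k \<ge> 2\<close>, so downward closure passes through
    \<open>2 * a\<close>.\<close>
  have two: "num (2 * a) > 0"
  proof -
    obtain k where k: "1 \<le> k" "2 * k < p" "b = of_nat k * a \<or> b = - (of_nat k * a)"
      by (rule small_multiple[OF a(2) b(2)])
    then have "k \<noteq> 1" using b by auto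
    moreover have "num (of_nat k * a) > 0"
      using k(3) b num_neg_pos[of b] by auto
    ultimately show ?thesis using num_multiple_downward[OF a k(2), of 2] k by simp
  qed
  have two_nz: "2 * a \<noteq> 0" using a(2) numeral_neq_0[of "num.Bit0 num.One"] p_ge_7 by simp
  define M where "M = p div 2"
  have M: "p = 2 * M + 1" using odd_p by (simp add: M_def)
  have "of_nat M * (2 * a) = of_nat (p - 1) * a" using M by (simp add: mult_ac)
  also have "\<dots> = - a" using of_nat_diff_mult[of 1 a] p_ge_7 by simp
  finally have MM: "num (of_nat M * (2 * a)) > 0" using num_neg_pos[OF a] by simp
  obtain k where k: "1 \<le> k" "2 * k < p" "c = of_nat k * (2 * a) \<or> c = - (of_nat k * (2 * a))"
    by (rule small_multiple[OF two_nz c])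
  then have pos: "num (of_nat k * (2 * a)) > 0"
    using num_multiple_downward[OF two two_nz _ MM] M by simp
  show ?thesis
  proof (cases "c = of_nat k * (2 * a)")
    case False
    then have ceq: "c = - (of_nat k * (2 * a))" using k by simp
    then have "of_nat k * (2 * a) \<noteq> 0" using c by auto
    then show ?thesis unfolding ceq using num_neg_pos[OF pos] by simp
  qed (use pos in simp)
qed

end

subsection \<open>Discharging when all symbols occur\<close>

context dual_word
begin

lemma occ_pos_iff: "a \<noteq> 0 \<Longrightarrow> occ l a > 0 \<longleftrightarrow> (\<exists>x\<in>l. x \<in> pts a)"
  by (auto simp: occ_def card_gt_0_iff finite_pts)

lemma lift_sum_Int_pts: "lift_sum a (l \<inter> pts b) = occ l b * residue (b / a)"
  by (simp add: lift_sum_def occ_def pts_def)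

lemma residue_minus_two:
  assumes "(a :: 'r mod_ring) \<noteq> 0"
  shows "residue (- (2 * a) / a) = p - 2"
proof -
  have "- (2 * a) = of_nat (p - 2) * a" using of_nat_diff_mult[of 2 a] p_ge_7 by simp
  then show ?thesis using residue_of_nat_mult_div[OF assms, of "p - 2"] p_ge_7 by simp
qed

lemma residue_four: "a \<noteq> 0 \<Longrightarrow> residue (4 * a / (a :: 'r mod_ring)) = 4"
  using residue_of_nat_mult_div[of a 4] p_ge_7 by simp

text \<open>The symbols \<open>a\<close> and \<open>- (2 * a)\<close> have lifts 1 and
  \<open>p - 2\<close>. The rest \<open>R\<close> cannot be 1, because only \<open>a\<close> has
  lift 1.\<close>

lemma lift_sum_split:
  assumes "l \<in> L" "a \<noteq> 0"
  obtains R where "lift_sum a l = occ l a + (p - 2) * occ l (- (2 * a)) + R"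
    "4 * occ l (4 * a) \<le> R" "R \<noteq> 1"
proof -
  let ?b = "- (2 * a)"
  define Y where "Y = l - pts a - pts ?b"
  have fin: "finite l" by (rule finite_line[OF assms(1)])
  have res: "residue (?b / a) = p - 2" "residue (4 * a / a) = 4" "residue (a / a) = 1"
    using residue_minus_two residue_four assms(2) by auto
  have ne: "a \<noteq> ?b" "a \<noteq> 4 * a" "?b \<noteq> 4 * a" using res p_ge_7 by force+
  have "lift_sum a l = lift_sum a (l \<inter> pts a) + lift_sum a (l - pts a)"
    unfolding lift_sum_def using fin by (simp add: sum.Int_Diff[of l _ "pts a"])
  also have "lift_sum a (l - pts a) = lift_sum a ((l - pts a) \<inter> pts ?b) + lift_sum a Y"
    unfolding lift_sum_def Y_def using fin by (simp add: sum.Int_Diff[of "l - pts a" _ "pts ?b"])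
  also have "(l - pts a) \<inter> pts ?b = l \<inter> pts ?b" using ne by (auto simp: pts_def)
  finally have "lift_sum a l = occ l a + (p - 2) * occ l ?b + lift_sum a Y"
    by (simp only: lift_sum_Int_pts res) simp
  moreover have "4 * occ l (4 * a) \<le> lift_sum a Y"
  proof -
    have "l \<inter> pts (4 * a) \<subseteq> Y" using ne by (auto simp: Y_def pts_def)
    then have "lift_sum a (l \<inter> pts (4 * a)) \<le> lift_sum a Y"
      unfolding lift_sum_def using fin by (intro sum_mono2) (auto simp: Y_def)
    then show ?thesis unfolding lift_sum_Int_pts res by simp
  qed
  moreover have "lift_sum a Y \<noteq> 1"
  proof
    assume one: "lift_sum a Y = 1"
    then have "(\<Sum>y\<in>Y. residue (v y / a)) \<noteq> 0" by (simp add: lift_sum_def)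
    then obtain y where y: "y \<in> Y" "residue (v y / a) \<noteq> 0"
      by (rule sum.not_neutral_contains_not_neutral)
    have "residue (v y / a) \<le> lift_sum a Y"
      unfolding lift_sum_def using y fin by (intro member_le_sum) (auto simp: Y_def)
    then have "residue (v y / a) = 1" using y(2) one by linarith
    then have "residue (v y / a) = residue (1 :: 'r mod_ring)" by simp
    then have "v y / a = 1" by (simp only: residue_eq_iff)
    then have "v y = a" using assms(2) by simp
    then show False using y assms line_subset by (auto simp: Y_def pts_def)
  qed
  ultimately show ?thesis using that by simp
qed

text \<open>
  A line of excess 0 with symbol \<open>a\<close> that contains \<open>-2a\<close> has the symbols \<open>a, a, -2a\<close>, so its defect is 0.
\<close>

definition defect :: "'r mod_ring \<Rightarrow> 'a set \<Rightarrow> int" where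
  "defect a l = int (occ l (- (2 * a))) - int (occ l a) + 1 - int (excess a l)"

text \<open>The large lift \<open>p - 2\<close> of \<open>- (2 * a)\<close> leaves few
  possibilities: \<open>a\<close> occurs once, and \<open>- (2 * a)\<close> occurs twice for excess
  1 with rest 3, or three times for excess 2 with rest 5, or four times for excess 2 with rest 0.
  The rest bounds the occurrences of \<open>4 * a\<close>, which makes the defect of
  \<open>- (2 * a)\<close> negative and able to compensate.\<close>

lemma defect_pos:
  assumes l: "l \<in> L" "x \<in> l" "x \<in> pts a" "a \<noteq> 0" and j: "excess a l \<le> 2" and pos: "0 < defect a l"
  shows "occ l a = 1" "2 * defect a l \<le> int (occ l (- (2 * a)))" "defect (- (2 * a)) l < 0"
proof -
  define m1 m2 m4 j where "m1 = occ l a" and "m2 = occ l (- (2 * a))" and "m4 = occ l (4 * a)"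
    and "j = excess a l"
  obtain R where R: "lift_sum a l = m1 + (p - 2) * m2 + R" "4 * m4 \<le> R" "R \<noteq> 1"
    unfolding m1_def m2_def m4_def using lift_sum_split[OF l(1,4)] by blast
  have "v x = a" using l by (simp add: in_pts_iff)
  then have T: "p + p * j = m1 + (p - 2) * m2 + R"
    using R lift_sum_eq_excess[of l x a] l by (simp add: j_def)
  have m1: "1 \<le> m1" using occ_pos_iff[of a l] l by (auto simp: m1_def Suc_le_eq)
  have d: "defect a l = int m2 - int m1 + 1 - int j" by (simp add: defect_def m1_def m2_def j_def)
  have d': "defect (- (2 * a)) l \<le> int m4 - int m2 + 1"
    by (simp add: defect_def m4_def m2_def)
  have m2: "m1 + j \<le> m2" using pos d by linarith
  obtain r where r: "p = r + 2" "5 \<le> r" using p_ge_7 by (intro that[of "p - 2"]) auto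
  define k where "k = r * m2"
  have T': "(r + 2) + (r + 2) * j = m1 + k + R" using T r by (simp add: k_def)
  have "m1 = 1 \<and> 2 * (int m2 - int m1 + 1 - int j) \<le> int m2 \<and> m4 + 1 < m2"
  proof -
    consider "j = 0" | "j = 1" | "j = 2" using j unfolding j_def by linarith
    then show ?thesis
    proof cases
      case 1
      have "m2 < 2"
      proof (rule ccontr)
        assume "\<not> m2 < 2"
        then have "r * 2 \<le> k" unfolding k_def by (intro mult_left_mono) auto
        moreover have "r + 2 = m1 + k + R" using T' 1 by simp
        ultimately show False using r m1 by linarith
      qed
      then have "m2 = 1" "m1 = 1" using m2 m1 1 by auto
      then show ?thesis using T' 1 R(3) by (simp add: k_def)
    next
      case 2
      have "m2 < 3"
      proof (rule ccontr)
        assume "\<not> m2 < 3"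
        then have "r * 3 \<le> k" unfolding k_def by (intro mult_left_mono) auto
        moreover have "2 * r + 4 = m1 + k + R" using T' 2 by simp
        ultimately show False using r m1 by linarith
      qed
      then have "m2 = 2" "m1 = 1" using m2 m1 2 by auto
      then show ?thesis using T' 2 R(2) by (simp add: k_def)
    next
      case 3
      have "m2 < 5"
      proof (rule ccontr)
        assume "\<not> m2 < 5"
        then have "r * 5 \<le> k" unfolding k_def by (intro mult_left_mono) auto
        moreover have "3 * r + 6 = m1 + k + R" using T' 3 by simp
        ultimately show False using r m1 by linarith
      qed
      then consider "m2 = 3" "m1 = 1" | "m2 = 4" using m2 m1 3 by linarith
      then show ?thesis
      proof cases
        case 1
        then show ?thesis using T' 3 R(2) by (simp add: k_def)
      next
        case 2
        \<comment> \<open>The equation reads \<open>m1 + R = 8 - p\<close>, so only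
          \<open>p = 7\<close> survives.\<close>
        then have "m1 = 1" "R = 0" using T' 3 r m1 by (simp_all add: k_def)
        then show ?thesis using 3 R(2) 2 by simp
      qed
    qed
  qed
  then show "occ l a = 1" "2 * defect a l \<le> int (occ l (- (2 * a)))" "defect (- (2 * a)) l < 0"
    using d d' by (auto simp: m1_def m2_def)
qed

text \<open>The \<open>p\<^sup>2\<close> extra occurrences of \<open>x\<close> cancel against the
  \<open>p\<^sup>2 + 1\<close> summands 1 of the defects.\<close>

lemma sum_defect_pencil:
  assumes "x \<in> pts a" "a \<noteq> 0"
  shows "(\<Sum>l | l \<in> L \<and> x \<in> l. defect a l) = int (num (- (2 * a))) - int (num a) + 1 - int (total_excess a)"
proof -
  have x: "x \<in> P" "v x = a" using assms by (auto simp: pts_def)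
  have ne: "a \<noteq> - (2 * a)"
  proof
    assume "a = - (2 * a)"
    then have "residue (a / a) = residue (- (2 * a) / a)" by metis
    then show False using residue_minus_two[OF assms(2)] assms(2) p_ge_7 by simp
  qed
  have "(\<Sum>l | l \<in> L \<and> x \<in> l. defect a l) =
      int (\<Sum>l | l \<in> L \<and> x \<in> l. occ l (- (2 * a))) - int (\<Sum>l | l \<in> L \<and> x \<in> l. occ l a)
      + int (card {l \<in> L. x \<in> l}) - int (\<Sum>l | l \<in> L \<and> x \<in> l. excess a l)"
    by (simp add: defect_def sum.distrib sum_subtractf)
  then show ?thesis
    using sum_occ_pencil[OF x(1)] sum_excess[OF assms] card_pencil[OF x(1)] x(2) ne by simp
qed

text \<open>Counting flags works because the pencil sum of the defects is the same at every point of
  symbol \<open>a\<close>.\<close>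

lemma sum_occ_defect:
  assumes "a \<noteq> 0"
  shows "(\<Sum>l\<in>L. int (occ l a) * defect a l) =
    int (num a) * (int (num (- (2 * a))) - int (num a) + 1 - int (total_excess a))"
proof -
  have "(\<Sum>l\<in>L. int (occ l a) * defect a l) = (\<Sum>l\<in>L. \<Sum>x\<in>l \<inter> pts a. defect a l)"
    by (simp add: occ_def)
  also have "\<dots> = (\<Sum>x\<in>pts a. \<Sum>l | l \<in> L \<and> x \<in> l. defect a l)"
    by (rule flag_sum[OF pts_subset, symmetric])
  also have "\<dots> = (\<Sum>x\<in>pts a. int (num (- (2 * a))) - int (num a) + 1 - int (total_excess a))"
    using sum_defect_pencil assms by (intro sum.cong refl) auto
  finally show ?thesis by (simp add: num_def)
qed

lemma bij_betw_times_nonzero: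
  "(c :: 'r mod_ring) \<noteq> 0 \<Longrightarrow> bij_betw (\<lambda>a. c * a) {a. a \<noteq> 0} {a. a \<noteq> 0}"
  by (rule bij_betw_byWitness[where f' = "\<lambda>a. a / c"]) auto

lemma sum_nonzero_times:
  "(c :: 'r mod_ring) \<noteq> 0 \<Longrightarrow> (\<Sum>a | a \<noteq> 0. f (c * a)) = (\<Sum>a | a \<noteq> 0. f a)"
  by (rule sum.reindex_bij_betw[OF bij_betw_times_nonzero])

lemma sum_num: "(\<Sum>a | a \<noteq> 0. num a) = card supp"
proof -
  have "card supp = card (\<Union>a\<in>{a. a \<noteq> 0}. pts a)"
    using supp_subset by (intro arg_cong[where f = card]) (auto simp: supp_def pts_def)
  also have "\<dots> = (\<Sum>a | a \<noteq> 0. card (pts a))"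
    by (rule card_UN_disjoint) (auto simp: pts_def finite_points)
  finally show ?thesis by (simp add: num_def)
qed

end

locale full_light_word = light_word p P L v
  for p :: nat and P :: "'a set" and L and v :: "'a \<Rightarrow> 'r::prime_card mod_ring" +
  assumes full: "\<And>a. a \<noteq> 0 \<Longrightarrow> num a > 0"
begin

lemma sum_total_excess: "2 * (\<Sum>a | a \<noteq> 0. total_excess a) = eps * (p - 1)"
proof -
  have "(\<Sum>a | a \<noteq> 0. total_excess (- a)) = (\<Sum>a | a \<noteq> 0. total_excess a)"
    using sum_nonzero_times[of "- 1" total_excess] by simp
  then have "2 * (\<Sum>a | a \<noteq> 0. total_excess a) = (\<Sum>a | a \<noteq> 0. total_excess a + total_excess (- a))"
    by (simp add: sum.distrib)
  also have "\<dots> = (\<Sum>a | a \<noteq> (0 :: 'r mod_ring). eps)"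
    using total_excess_add full by (intro sum.cong refl) auto
  finally show ?thesis using card_nonzero_mod_ring[where 'r='r] card_r by simp
qed

text \<open>The slacks \<open>s a\<close> in \<open>num_lower_bound\<close> are nonnegative, and the
  exact weight makes them sum to at most 4, so no single slack exceeds 4.\<close>

lemma num_upper_bound:
  assumes "b \<noteq> 0"
  shows "num b \<le> 2 * p + 5"
proof -
  define s where "s a = int (num a) + int (total_excess a) - (2 * int p + 1)" for a
  have s0: "0 \<le> s a" if "a \<noteq> 0" for a
    using num_lower_bound[OF full[OF that] that] by (simp add: s_def)
  have "s b \<le> (\<Sum>a | a \<noteq> 0. s a)"
    using assms s0 by (intro member_le_sum) auto
  also have "2 * (\<Sum>a | a \<noteq> 0. s a) =
      2 * int (card supp) + int (2 * (\<Sum>a | a \<noteq> 0. total_excess a)) - 2 * (2 * int p + 1) * (int p - 1)"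
    using card_nonzero_mod_ring[where 'r='r] card_r p_ge_7 sum_num
    by (simp add: s_def sum.distrib sum_subtractf of_nat_diff flip: of_nat_sum)
  finally have "2 * s b \<le> 2 * int (card supp) + int (eps * (p - 1)) - 2 * (2 * int p + 1) * (int p - 1)"
    by (simp only: sum_total_excess)
  moreover have "int (card supp) + 2 * int p = 2 * (int p)\<^sup>2 + 2 + int eps"
    using arg_cong[OF card_supp_eps[OF full[OF assms] assms], of int] by simp
  moreover have "int (eps * (p - 1)) \<le> 2 * int p - 2"
    using eps_le_2 p_ge_7 mult_right_mono[of "int eps" 2 "int (p - 1)"] by (simp add: of_nat_diff)
  moreover have "2 * (2 * int p + 1) * (int p - 1) = 4 * (int p)\<^sup>2 - 2 * int p - 2"
    by (simp add: algebra_simps power2_eq_square)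
  moreover have "int eps \<le> 2" using eps_le_2 by simp
  ultimately have "2 * s b \<le> 8" by (simp only:)
  then show ?thesis by (simp add: s_def)
qed

text \<open>All symbol counts lie between \<open>2 * p - 1\<close> and \<open>2 * p + 5\<close>. The
  ratio below 2 is beaten by the factor 2 in \<open>defect_pos\<close>.\<close>

lemma num_less_double:
  assumes "a \<noteq> 0" "b \<noteq> 0"
  shows "num b < 2 * num a"
proof -
  have "total_excess a \<le> 2" using total_excess_add[OF full[OF assms(1)] assms(1)] eps_le_2 by simp
  then show ?thesis
    using num_upper_bound[OF assms(2)] num_lower_bound[OF full[OF assms(1)] assms(1)] p_ge_7 by linarith
qed

text \<open>
  Dividing by \<open>num a\<close> gives every symbol the same total weight, so that the numbers \<open>num (-2a) - num a\<close>
  cancel in the sum over all symbols.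
\<close>

definition charge :: "'a set \<Rightarrow> 'r mod_ring \<Rightarrow> real" where
  "charge l a = real (occ l a) * real_of_int (defect a l) / real (num a)"

lemma minus_two_neq_0: "a \<noteq> 0 \<Longrightarrow> - (2 * a) \<noteq> (0 :: 'r mod_ring)"
  using numeral_neq_0[of "num.Bit0 num.One"] p_ge_7 by simp

text \<open>By \<open>defect_pos\<close> the occurrences of \<open>- (2 * a)\<close> outweigh the
  defect of \<open>a\<close> by a factor 2, and dividing by the symbol counts loses strictly less
  than that.\<close>

lemma charge_pos:
  assumes "l \<in> L" "a \<noteq> 0" "0 < charge l a"
  shows "charge l a < - charge l (- (2 * a))"
proof -
  have n: "num a > 0" "num (- (2 * a)) > 0" using full assms(2) minus_two_neq_0 by blast+
  have pos: "0 < occ l a" "0 < defect a l"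
    using assms(3) n by (auto simp: charge_def zero_less_mult_iff zero_less_divide_iff)
  obtain x where x: "x \<in> l" "x \<in> pts a" using pos(1) occ_pos_iff[OF assms(2)] by auto
  have "excess a l \<le> 2"
    using excess_le_total[OF assms(1) x assms(2)] total_excess_add[OF n(1) assms(2)] eps_le_2 by linarith
  note d = defect_pos[OF assms(1) x assms(2) this pos(2)]
  define m where "m = real (occ l (- (2 * a)))"
  have m: "m > 0" using d(2) pos(2) by (simp add: m_def)
  have "charge l a = real_of_int (defect a l) / num a" using d(1) by (simp add: charge_def)
  also have "\<dots> \<le> (m / 2) / num a"
    using d(2) by (intro divide_right_mono) (auto simp: m_def)
  also have "\<dots> = m / (2 * num a)" by simp
  also have "\<dots> < m / num (- (2 * a))"
    using num_less_double[OF assms(2) minus_two_neq_0[OF assms(2)]] n m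
    by (intro divide_strict_left_mono) (auto simp flip: of_nat_mult)
  also have "\<dots> \<le> m * real_of_int (- defect (- (2 * a)) l) / num (- (2 * a))"
    using d(3) m mult_left_mono[of 1 "real_of_int (- defect (- (2 * a)) l)" m]
    by (intro divide_right_mono) auto
  also have "\<dots> = - charge l (- (2 * a))" by (simp add: charge_def m_def)
  finally show ?thesis .
qed

text \<open>The positive part of the charge at \<open>a\<close> is matched with the negative part at
  \<open>- (2 * a)\<close>; this matching permutes the nonzero symbols.\<close>

lemma sum_charge_le_0:
  assumes "l \<in> L"
  shows "(\<Sum>a | a \<noteq> 0. charge l a) \<le> 0"
    and "\<lbrakk>b \<noteq> 0; charge l b > 0\<rbrakk> \<Longrightarrow> (\<Sum>a | a \<noteq> 0. charge l a) < 0"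
proof -
  have "(\<Sum>a | a \<noteq> 0. charge l a) = (\<Sum>a | a \<noteq> 0. max (charge l a) 0 - max (- charge l a) 0)"
    by (intro sum.cong) auto
  also have "\<dots> = (\<Sum>a | a \<noteq> 0. max (charge l a) 0) - (\<Sum>a | a \<noteq> 0. max (- charge l a) 0)"
    by (rule sum_subtractf)
  also have "(\<Sum>a | a \<noteq> 0. max (- charge l a) 0) = (\<Sum>a | a \<noteq> 0. max (- charge l (- (2 * a))) 0)"
    using sum_nonzero_times[of "- 2" "\<lambda>a. max (- charge l a) 0"] minus_two_neq_0[of 1] by simp
  finally have eq: "(\<Sum>a | a \<noteq> 0. charge l a) =
    (\<Sum>a | a \<noteq> 0. max (charge l a) 0) - (\<Sum>a | a \<noteq> 0. max (- charge l (- (2 * a))) 0)" .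
  have le: "max (charge l a) 0 \<le> max (- charge l (- (2 * a))) 0" if "a \<noteq> 0" for a
    using charge_pos[OF assms that] by (cases "charge l a > 0") auto
  show "(\<Sum>a | a \<noteq> 0. charge l a) \<le> 0"
    unfolding eq using sum_mono[of "{a. a \<noteq> 0}", OF le] by simp
  assume b: "b \<noteq> 0" "charge l b > 0"
  have "(\<Sum>a | a \<noteq> 0. max (charge l a) 0) < (\<Sum>a | a \<noteq> 0. max (- charge l (- (2 * a))) 0)"
  proof (rule sum_strict_mono_ex1)
    show "\<exists>a\<in>{a. a \<noteq> 0}. max (charge l a) 0 < max (- charge l (- (2 * a))) 0"
      using charge_pos[OF assms b] b by (intro bexI[of _ b]) auto
  qed (use le in auto)
  then show "(\<Sum>a | a \<noteq> 0. charge l a) < 0" unfolding eq by simp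
qed

text \<open>After swapping the sums, each symbol contributes its pencil sum of defects. The
  differences of symbol counts cancel, and the total excesses sum to
  \<open>eps * (p - 1) / 2\<close>.\<close>

lemma sum_charge: "2 * (\<Sum>l\<in>L. \<Sum>a | a \<noteq> 0. charge l a) = (2 - real eps) * (real p - 1)"
proof -
  have "(\<Sum>l\<in>L. \<Sum>a | a \<noteq> 0. charge l a) = (\<Sum>a | a \<noteq> 0. \<Sum>l\<in>L. charge l a)"
    by (rule sum.swap)
  also have "\<dots> = (\<Sum>a | a \<noteq> 0. real (num (- (2 * a))) - real (num a) + 1 - real (total_excess a))"
  proof (intro sum.cong refl)
    fix a :: "'r mod_ring" assume a: "a \<in> {a. a \<noteq> 0}"
    have "(\<Sum>l\<in>L. charge l a) = real_of_int (\<Sum>l\<in>L. int (occ l a) * defect a l) / num a"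
      by (simp add: charge_def sum_divide_distrib)
    also have "\<dots> = real (num (- (2 * a))) - real (num a) + 1 - real (total_excess a)"
      using sum_occ_defect[of a] full[of a] a by simp
    finally show "(\<Sum>l\<in>L. charge l a) = \<dots>" .
  qed
  also have "\<dots> = (\<Sum>a | a \<noteq> 0. real (num (- (2 * a)))) - (\<Sum>a | a \<noteq> 0. real (num a)) + (real p - 1)
      - real (\<Sum>a | a \<noteq> 0. total_excess a)"
    using card_nonzero_mod_ring[where 'r='r] card_r p_ge_7
    by (simp add: sum.distrib sum_subtractf of_nat_diff)
  also have "(\<Sum>a | a \<noteq> 0. real (num (- (2 * a)))) = (\<Sum>a | a \<noteq> 0. real (num a))"
    using sum_nonzero_times[of "- 2" "\<lambda>a. real (num a)"] minus_two_neq_0[of 1] by simp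
  finally have "2 * (\<Sum>l\<in>L. \<Sum>a | a \<noteq> 0. charge l a) =
      2 * (real p - 1) - real (2 * (\<Sum>a | a \<noteq> 0. total_excess a))"
    by simp
  also have "\<dots> = 2 * (real p - 1) - real eps * (real p - 1)"
    unfolding sum_total_excess using p_ge_7 by (simp add: of_nat_diff)
  finally show ?thesis by (simp add: algebra_simps)
qed

text \<open>The charges sum to at most 0 on each line, but to at least 0 overall since
  \<open>eps \<le> 2\<close>. So the total is 0, which forces \<open>eps = 2\<close>, and every line
  sum is 0. By the strict part of \<open>sum_charge_le_0\<close> no charge is positive, hence all
  vanish.\<close>

lemma eps_eq_2: "eps = 2"
  and defect_eq_0: "\<lbrakk>l \<in> L; x \<in> l; x \<in> pts a; a \<noteq> 0\<rbrakk> \<Longrightarrow> defect a l = 0"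
proof -
  have nonpos: "(\<Sum>l\<in>L. \<Sum>a | a \<noteq> 0. charge l a) \<le> 0"
    using sum_charge_le_0(1) by (rule sum_nonpos)
  have "0 \<le> (2 - real eps) * (real p - 1)" using eps_le_2 p_ge_7 by simp
  then have zero: "(\<Sum>l\<in>L. \<Sum>a | a \<noteq> 0. charge l a) = 0" using sum_charge nonpos by linarith
  then show "eps = 2" using sum_charge p_ge_7 by auto
  assume l: "l \<in> L" "x \<in> l" "x \<in> pts a" "a \<noteq> 0"
  have "(\<Sum>l\<in>L. - (\<Sum>a | a \<noteq> 0. charge l a)) = 0" using zero by (simp add: sum_negf)
  then have l0: "(\<Sum>a | a \<noteq> 0. charge l a) = 0"
    using sum_nonneg_eq_0_iff[OF finite_lines, of "\<lambda>l. - (\<Sum>a | a \<noteq> 0. charge l a)"]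
      sum_charge_le_0(1) l(1) by simp
  have le: "charge l b \<le> 0" if "b \<noteq> 0" for b
    using sum_charge_le_0(2)[OF l(1) that] l0 by force
  have "(\<Sum>a | a \<noteq> 0. - charge l a) = 0" using l0 by (simp add: sum_negf)
  then have "charge l a = 0"
    using sum_nonneg_eq_0_iff[of "{a. a \<noteq> 0}" "\<lambda>a. - charge l a"] le l(4) by simp
  moreover have "occ l a > 0" using l occ_pos_iff by auto
  ultimately show "defect a l = 0" using full[OF l(4)] by (simp add: charge_def)
qed

end

section \<open>Following doubled symbols along a long line\<close>

context full_light_word
begin

lemma num_minus_two:
  assumes "a \<noteq> 0"
  shows "num (- (2 * a)) + 1 = num a + total_excess a"
proof -
  obtain x where x: "x \<in> pts a" using full[OF assms] num_pos_iff by auto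
  have "(\<Sum>l | l \<in> L \<and> x \<in> l. defect a l) = 0"
    using defect_eq_0[OF _ _ x assms] by (intro sum.neutral) auto
  then show ?thesis using sum_defect_pencil[OF x assms] by simp
qed

text \<open>Add \<open>num_minus_two\<close> for \<open>a\<close> and \<open>- a\<close>; their
  total excesses sum to 2.\<close>

lemma pair_num_double:
  assumes "a \<noteq> 0"
  shows "pair_num (2 * a) = pair_num a"
  using num_minus_two[OF assms] num_minus_two[of "- a"] assms
    total_excess_add[OF full[OF assms] assms] eps_eq_2
  by (simp add: pair_num_def)

lemma pair_num_ge: "a \<noteq> 0 \<Longrightarrow> 4 * p \<le> pair_num a"
  using pair_num_lower_bound[of a] full[of a] eps_eq_2 by simp

lemma sum_pair_num: "(\<Sum>a | a \<noteq> 0. pair_num a) + 4 * p = 4 * p\<^sup>2 + 8"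
proof -
  have "(\<Sum>a | a \<noteq> 0. pair_num a) = 2 * card supp"
    using sum_nonzero_times[of "- 1" num] by (simp add: pair_num_def sum.distrib sum_num)
  moreover have "card supp + 2 * p = 2 * p\<^sup>2 + 4"
    using card_supp_eps[OF full[of 1]] eps_eq_2 by simp
  ultimately show ?thesis by simp
qed

text \<open>
  The total slack is only 8 over \<open>p - 1\<close> symbols. This settles all primes but 7, where \<open>pair_num\<close> is constant
  because doubling is transitive on symbols up to sign, and 6 does not divide the sum.
\<close>

lemma ex_pair_num_eq: "\<exists>a. a \<noteq> 0 \<and> pair_num a = 4 * p"
proof (rule ccontr)
  assume "\<not> ?thesis"
  then have gt: "4 * p + 1 \<le> pair_num a" if "a \<noteq> 0" for a
    using pair_num_ge[OF that] that by (metis Suc_eq_plus1 Suc_leI le_neq_implies_less)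
  have c: "card {a :: 'r mod_ring. a \<noteq> 0} = p - 1"
    using card_nonzero_mod_ring[where 'r='r] card_r by simp
  have "(\<Sum>a :: 'r mod_ring | a \<noteq> 0. 4 * p + 1) \<le> (\<Sum>a | a \<noteq> 0. pair_num a)"
    using gt by (intro sum_mono) auto
  then have "(p - 1) * (4 * p + 1) + 4 * p \<le> 4 * p\<^sup>2 + 8"
    using sum_pair_num c by simp
  moreover obtain r where r: "p = r + 1" using p_ge_7 by (intro that[of "p - 1"]) simp
  ultimately have "p \<le> 9" by (simp add: algebra_simps power2_eq_square)
  then have "p = 7 \<or> p = 8 \<or> p = 9" using p_ge_7 by linarith
  moreover have "p \<noteq> 8" using odd_p by auto
  moreover have "p \<noteq> 9"
  proof
    assume "p = 9"
    then show False using prime_nat_not_dvd[OF prime_p, of 3] by simp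
  qed
  ultimately have p7: "p = 7" by auto
  have const: "pair_num b = pair_num 1" if b: "b \<noteq> 0" for b
  proof -
    obtain k where k: "1 \<le> k" "2 * k < p" "b = of_nat k * 1 \<or> b = - (of_nat k * 1)"
      by (rule small_multiple[OF one_neq_zero b])
    have two: "pair_num 2 = pair_num 1" using pair_num_double[of 1] by simp
    \<comment> \<open>Modulo 7 one has \<open>3 = - 4\<close>, so doubling links 1, 2 and, up to
      sign, 3.\<close>
    have "(of_nat 7 :: 'r mod_ring) = 0" using of_nat_eq_0_iff[of 7] p7 by simp
    then have "(3 :: 'r mod_ring) = - 4" by (simp add: eq_neg_iff_add_eq_0)
    then have "pair_num 3 = pair_num (- 4)" by (rule arg_cong[of _ _ pair_num])
    also have "\<dots> = pair_num 4" by (rule pair_num_minus)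
    also have "\<dots> = pair_num 2" using pair_num_double[of 2] numeral_neq_0[of "num.Bit0 num.One"] p7 by simp
    finally have three: "pair_num 3 = pair_num 1" using two by simp
    consider "k = 1" | "k = 2" | "k = 3" using k p7 by linarith
    then have "pair_num (of_nat k) = pair_num 1" by cases (simp_all add: two three)
    then show ?thesis using k(3) by auto
  qed
  have "(\<Sum>a | a \<noteq> 0. pair_num a) = (\<Sum>a :: 'r mod_ring | a \<noteq> 0. pair_num 1)"
    by (intro sum.cong refl const) simp
  then have "6 * pair_num 1 + 28 = 204"
    using sum_pair_num c p7 by simp
  then show False by presburger
qed

text \<open>The value \<open>4 * p\<close> is least possible and forces equality in
  \<open>num_lower_bound\<close> for both \<open>a\<close> and \<open>- a\<close>. Then
  \<open>num_minus_two\<close> gives \<open>2 * p\<close> points for each of the symbols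
  \<open>2 * a\<close> and \<open>- (2 * a)\<close>, and the same lower bound leaves each of them
  total excess 1.\<close>

lemma tight_symbol:
  assumes a: "a \<noteq> 0" "pair_num a = 4 * p"
  shows "total_excess (- (2 * a)) = 1" "num (2 * a) = 2 * p"
proof -
  have nz: "2 * a \<noteq> 0" using minus_two_neq_0[OF a(1)] by auto
  have "num a + total_excess a = 2 * p + 1" "num (- a) + total_excess (- a) = 2 * p + 1"
    using num_lower_bound[OF full[OF a(1)] a(1)] num_lower_bound[of "- a"] full[of "- a"] a
      total_excess_add[OF full[OF a(1)] a(1)] eps_eq_2
    by (auto simp: pair_num_def)
  then have n: "num (- (2 * a)) = 2 * p" "num (2 * a) = 2 * p"
    using num_minus_two[OF a(1)] num_minus_two[of "- a"] a by auto
  have "pair_num (2 * a) = 4 * p" using pair_num_double[OF a(1)] a by simp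
  then have "num (2 * a) + total_excess (2 * a) + (num (- (2 * a)) + total_excess (- (2 * a))) = 4 * p + 2"
    using total_excess_add[OF full[OF nz] nz] eps_eq_2 by (simp add: pair_num_def)
  moreover have "2 * p + 1 \<le> num (2 * a) + total_excess (2 * a)"
    "2 * p + 1 \<le> num (- (2 * a)) + total_excess (- (2 * a))"
    using num_lower_bound[OF full] nz by auto
  ultimately show "total_excess (- (2 * a)) = 1" using n by linarith
  show "num (2 * a) = 2 * p" by (rule n)
qed

text \<open>The values from \<open>tight_symbol\<close> give equality in
  \<open>num_neg_lower_bound\<close>, hence on each line. As the excess is at most 1, a line with at
  least four support points has exactly four and excess 1. Its zero defect then makes
  \<open>- (2 * b)\<close> as frequent as \<open>b\<close>.\<close>

lemma next_on_long_line:
  assumes a: "a \<noteq> 0" "pair_num a = 4 * p" and b: "b = - (2 * a)"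
    and l: "l \<in> L" "x \<in> l" "x \<in> pts b" "4 \<le> card (l \<inter> supp)"
  shows "card (l \<inter> supp) \<le> 4" "\<exists>y\<in>l. y \<in> pts (- (2 * b))"
proof -
  have nz: "b \<noteq> 0" using minus_two_neq_0[OF a(1)] b by simp
  have tb: "total_excess b = 1" "num (- b) = 2 * p" using tight_symbol[OF a] b by auto
  have "card supp + 2 * p = 2 * p\<^sup>2 + 4"
    using card_supp_eps[OF full[OF nz] nz] eps_eq_2 by simp
  then have "2 * p\<^sup>2 + 3 + total_excess b = card supp + num (- b)" using tb by simp
  then have eq: "excess b l + 3 = card (l \<inter> supp) + occ l (- b)"
    by (rule excess_add_3_eq_occ[OF l(1,2,3) nz])
  moreover have "excess b l \<le> 1" using excess_le_total[OF l(1,2,3) nz] tb by simp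
  ultimately show "card (l \<inter> supp) \<le> 4" by simp
  have "1 \<le> excess b l" using eq l(4) by simp
  moreover have "occ l b \<ge> 1" using occ_pos_iff[OF nz, of l] l by (auto simp: Suc_le_eq)
  ultimately have "occ l (- (2 * b)) > 0"
    using defect_eq_0[OF l(1,2,3) nz] by (simp add: defect_def)
  then show "\<exists>y\<in>l. y \<in> pts (- (2 * b))" using occ_pos_iff[OF minus_two_neq_0[OF nz]] by simp
qed

text \<open>The symbol \<open>a = - (2 * c)\<close> inherits total excess 1 from a tight
  \<open>c\<close>, so some line through a point of symbol \<open>a\<close> has positive excess and
  at least four support points. Iterating \<open>next_on_long_line\<close> fills it with four
  symbols whose sum is nonzero.\<close>

theorem full_light_word_impossible: False
proof -
  obtain c where c: "c \<noteq> 0" "pair_num c = 4 * p" using ex_pair_num_eq by blast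
  define a where "a = - (2 * c)"
  have step: "d \<noteq> 0 \<Longrightarrow> pair_num d = 4 * p \<Longrightarrow> - (2 * d) \<noteq> 0 \<and> pair_num (- (2 * d)) = 4 * p" for d
    using minus_two_neq_0[of d] pair_num_double[of d] by simp
  have a: "a \<noteq> 0" "pair_num a = 4 * p" using step[OF c] by (auto simp: a_def)
  have a2: "- (2 * a) \<noteq> 0" "pair_num (- (2 * a)) = 4 * p" using step[OF a] by auto
  have a8: "- (2 * (4 * a)) \<noteq> 0" using step[OF step[OF a2, THEN conjunct1]] step[OF a2] by simp
  have a4: "4 * a \<noteq> 0" using step[OF a2] by simp
  obtain x where x: "x \<in> pts a" using full[OF a(1)] num_pos_iff by auto
  have "total_excess a = 1" using tight_symbol(1)[OF c] by (simp add: a_def)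
  then have "(\<Sum>l | l \<in> L \<and> x \<in> l. excess a l) \<noteq> 0" using sum_excess[OF x a(1)] by simp
  then obtain l where "l \<in> {l \<in> L. x \<in> l}" "excess a l \<noteq> 0"
    by (rule sum.not_neutral_contains_not_neutral)
  then have l: "l \<in> L" "x \<in> l" and ex: "excess a l \<noteq> 0" by auto
  have long: "4 \<le> card (l \<inter> supp)"
    using excess_add_3_le[OF l x a(1)] ex by (cases "card (l \<inter> supp) = 2") auto
  obtain y where y: "y \<in> l" "y \<in> pts (- (2 * a))"
    using next_on_long_line(2)[OF c a_def l x long] by blast
  obtain z where z: "z \<in> l" "z \<in> pts (4 * a)"
    using next_on_long_line(2)[OF a refl l(1) y long] by auto
  obtain u where u: "u \<in> l" "u \<in> pts (- (2 * (4 * a)))"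
    using next_on_long_line(2)[OF a2 _ l(1) z long] by auto
  have v: "v x = a" "v y = - (2 * a)" "v z = 4 * a" "v u = - (8 * a)"
    using x y z u a a2 a4 a8 by (auto simp: pts_def)
  have n3: "(3 :: 'r mod_ring) \<noteq> 0" "(5 :: 'r mod_ring) \<noteq> 0" "(2 :: 'r mod_ring) \<noteq> 0"
    using numeral_neq_0[of "num.Bit1 num.One"] numeral_neq_0[of "num.Bit1 (num.Bit0 num.One)"]
      numeral_neq_0[of "num.Bit0 num.One"] p_ge_7 by auto
  have zero: "k * a \<noteq> 0" if "k \<noteq> 0" for k :: "'r mod_ring" using a(1) that by simp
  have "(9 :: 'r mod_ring) = 3 * 3" "(6 :: 'r mod_ring) = 2 * 3" "(12 :: 'r mod_ring) = 2 * (2 * 3)" by simp_all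
  then have n9: "(9 :: 'r mod_ring) \<noteq> 0" "(6 :: 'r mod_ring) \<noteq> 0" "(12 :: 'r mod_ring) \<noteq> 0"
    using n3 by (metis mult_eq_0_iff)+
  \<comment> \<open>The coefficients 3, 6, 9 and 12 have only the prime factors 2 and 3, so no
    difference vanishes for \<open>p \<ge> 7\<close>.\<close>
  have "v x - v y = 3 * a" "v z - v x = 3 * a" "v x - v u = 9 * a"
    "v z - v y = 6 * a" "v y - v u = 6 * a" "v z - v u = 12 * a"
    unfolding v by simp_all
  then have dist: "x \<noteq> y" "x \<noteq> z" "x \<noteq> u" "y \<noteq> z" "y \<noteq> u" "z \<noteq> u"
    using zero[OF n3(1)] zero[OF n9(1)] zero[OF n9(2)] zero[OF n9(3)] by auto
  have sub: "{x, y, z, u} \<subseteq> l \<inter> supp"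
    using l y z u v a a2 a4 a8 by (auto simp: supp_def)
  have "{x, y, z, u} = l \<inter> supp"
    using next_on_long_line(1)[OF a refl l(1) y long] dist sub finite_supp
    by (intro card_seteq) auto
  then have "(\<Sum>w\<in>l. v w) = (\<Sum>w\<in>{x, y, z, u}. v w)"
    using finite_line[OF l(1)] by (intro sum.mono_neutral_right) (auto simp: supp_def)
  also have "\<dots> = a + (- (2 * a) + (4 * a + - (8 * a)))" using dist v by simp
  also have "\<dots> = - (5 * a)" by simp
  finally show False using line_sum_eq_0[OF l(1)] zero[OF n3(2)] by simp
qed

end

subsection \<open>Words with two symbols\<close>

text \<open>Counting gives \<open>n + 1\<close> lines through each point \<open>x\<close>. For a
  line \<open>m\<close> off \<open>x\<close>, the joins of \<open>x\<close> with the
  \<open>n + 1\<close> points of \<open>m\<close> are therefore the whole pencil, so any two lines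
  meet.\<close>

lemma projective_plane_of_orderI:
  fixes S :: "'a set" and K :: "'a set set"
  assumes fin: "finite S" and n: "n \<ge> 2" and card_S: "card S = n\<^sup>2 + n + 1"
    and sub: "K \<subseteq> Pow S" and card_l: "\<And>l. l \<in> K \<Longrightarrow> card l = n + 1"
    and ex1: "\<And>x y. \<lbrakk>x \<in> S; y \<in> S; x \<noteq> y\<rbrakk> \<Longrightarrow> \<exists>!l. l \<in> K \<and> x \<in> l \<and> y \<in> l"
  shows "projective_plane_of_order n S K"
proof -
  have finK: "finite K" using sub fin by (meson finite_Pow_iff finite_subset)
  have finl: "finite l" if "l \<in> K" for l using that sub fin by (meson PowD finite_subset subsetD)
  have uniq: "l = m" if "l \<in> K" "m \<in> K" "x \<in> l" "x \<in> m" "y \<in> l" "y \<in> m" "x \<noteq> y" for l m x y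
  proof -
    have "x \<in> S" "y \<in> S" using that sub by auto
    then show ?thesis using ex1[of x y] that by blast
  qed
  have pencil: "card {l \<in> K. x \<in> l} = n + 1" if x: "x \<in> S" for x
  proof -
    have "S - {x} = (\<Union>l\<in>{l \<in> K. x \<in> l}. l - {x})"
    proof
      show "S - {x} \<subseteq> (\<Union>l\<in>{l \<in> K. x \<in> l}. l - {x})"
      proof
        fix y assume y: "y \<in> S - {x}"
        then have "\<exists>l. l \<in> K \<and> x \<in> l \<and> y \<in> l" using ex1[of x y] x by auto
        then show "y \<in> (\<Union>l\<in>{l \<in> K. x \<in> l}. l - {x})" using y by auto
      qed
    qed (use sub in auto)
    then have "card (S - {x}) = card (\<Union>l\<in>{l \<in> K. x \<in> l}. l - {x})" by simp
    also have "\<dots> = (\<Sum>l\<in>{l \<in> K. x \<in> l}. card (l - {x}))"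
    proof (rule card_UN_disjoint)
      show "\<forall>l\<in>{l \<in> K. x \<in> l}. \<forall>m\<in>{l \<in> K. x \<in> l}. l \<noteq> m \<longrightarrow> (l - {x}) \<inter> (m - {x}) = {}"
      proof (intro ballI impI)
        fix l m assume "l \<in> {l \<in> K. x \<in> l}" "m \<in> {l \<in> K. x \<in> l}" "l \<noteq> m"
        then show "(l - {x}) \<inter> (m - {x}) = {}" using uniq[of l m x] by auto
      qed
    qed (use finK finl in auto)
    also have "\<dots> = (\<Sum>l\<in>{l \<in> K. x \<in> l}. n)"
      using card_l finl by (intro sum.cong refl) auto
    finally have "card {l \<in> K. x \<in> l} * n = (n + 1) * n"
      using x fin card_S by (simp add: card_Diff_singleton power2_eq_square)
    then show ?thesis using n by (simp only: mult_cancel2) simp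
  qed
  have meet: "\<exists>x. x \<in> l \<and> x \<in> m" if l: "l \<in> K" and m: "m \<in> K" for l m
  proof -
    obtain x where x: "x \<in> l" using card_l[OF l] by fastforce
    then have xS: "x \<in> S" using l sub by auto
    show ?thesis
    proof (cases "x \<in> m")
      case False
      define g where "g y = (THE k. k \<in> K \<and> x \<in> k \<and> y \<in> k)" for y
      have g: "g y \<in> K \<and> x \<in> g y \<and> y \<in> g y" if "y \<in> m" for y
        unfolding g_def by (rule theI', rule ex1) (use that False xS m sub in auto)
      have inj: "inj_on g m"
      proof (rule inj_onI, rule ccontr)
        fix y z assume yz: "y \<in> m" "z \<in> m" "g y = g z" "y \<noteq> z"
        then have "g y = m" using uniq[of "g y" m y z] g[of y] g[of z] m by auto
        then show False using g[OF yz(1)] False by simp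
      qed
      have "g ` m = {k \<in> K. x \<in> k}"
      proof (rule card_seteq)
        show "finite {k \<in> K. x \<in> k}" using finK by simp
        show "g ` m \<subseteq> {k \<in> K. x \<in> k}" using g by auto
        show "card {k \<in> K. x \<in> k} \<le> card (g ` m)"
          using pencil[OF xS] card_image[OF inj] card_l[OF m] by simp
      qed
      then have "l \<in> g ` m" using l x by simp
      then obtain y where "l = g y" "y \<in> m" by (rule imageE)
      then show ?thesis using g[of y] by auto
    qed (use x in auto)
  qed
  \<comment> \<open>Take two points on each of two lines through \<open>s\<close>, avoiding
    \<open>s\<close>.\<close>
  have quad: "\<exists>Q\<subseteq>S. card Q = 4 \<and> (\<forall>l\<in>K. card (l \<inter> Q) \<le> 2)"
  proof -
    have "\<not> card S \<le> Suc 0" using card_S n by (simp add: power2_eq_square)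
    then obtain s t where st: "s \<in> S" "t \<in> S" "s \<noteq> t" using fin by (auto simp: card_le_Suc0_iff_eq)
    then obtain l1 where l1: "l1 \<in> K" "s \<in> l1" using ex1[OF st] by blast
    have "\<not> S \<subseteq> l1"
    proof
      assume "S \<subseteq> l1"
      then have "card S \<le> n + 1" using card_mono[OF finl[OF l1(1)]] card_l[OF l1(1)] by metis
      then show False using card_S n by (simp add: power2_eq_square)
    qed
    then obtain y where y: "y \<in> S" "y \<notin> l1" by blast
    then obtain l2 where l2: "l2 \<in> K" "s \<in> l2" "y \<in> l2" using ex1[of s y] st l1 by blast
    have ne: "l1 \<noteq> l2" using y l2 by auto
    have "2 \<le> card (l1 - {s})" "2 \<le> card (l2 - {s})"
      using card_l l1 l2 finl n by (auto simp: card_Diff_singleton)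
    then obtain X Y where X: "X \<subseteq> l1 - {s}" "card X = 2" and Y: "Y \<subseteq> l2 - {s}" "card Y = 2"
      by (meson obtain_subset_with_card_n)
    have only: "z = s" if "z \<in> l1" "z \<in> l2" for z
      using uniq[OF l1(1) l2(1) l1(2) l2(2) that] ne by blast
    have dis: "X \<inter> Y = {}" "l1 \<inter> Y = {}" "l2 \<inter> X = {}" using X Y only by blast+
    have fXY: "finite X" "finite Y" using X(1) Y(1) finl l1 l2 by (meson finite_Diff finite_subset)+
    have "card (m \<inter> (X \<union> Y)) \<le> 2" if m: "m \<in> K" for m
    proof -
      have one: "card (m \<inter> l) \<le> 1" if "l \<in> K" "m \<noteq> l" for l
        using uniq[OF m that(1)] that finl by (auto simp: card_le_Suc0_iff_eq)
      have "card (m \<inter> (X \<union> Y)) \<le> card (m \<inter> X) + card (m \<inter> Y)"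
        unfolding Int_Un_distrib by (rule card_Un_le)
      moreover have "card (m \<inter> X) \<le> card (m \<inter> l1)" "card (m \<inter> Y) \<le> card (m \<inter> l2)"
        using X Y finl[OF l1(1)] finl[OF l2(1)] by (auto intro!: card_mono)
      moreover have "m = l1 \<Longrightarrow> m \<inter> Y = {}" "m = l2 \<Longrightarrow> m \<inter> X = {}" using dis by auto
      moreover have "card (m \<inter> X) \<le> 2" "card (m \<inter> Y) \<le> 2"
        using X(2) Y(2) fXY by (metis card_mono inf_le2)+
      ultimately show ?thesis
        using one[OF l1(1)] one[OF l2(1)] by (cases "m = l1"; cases "m = l2") auto
    qed
    moreover have "card (X \<union> Y) = 4" using card_Un_disjoint[OF fXY dis(1)] X Y by simp
    moreover have "X \<union> Y \<subseteq> S" using X Y sub l1 l2 by blast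
    ultimately show ?thesis by blast
  qed
  have point: "\<exists>!x. x \<in> l \<and> x \<in> m" if lm: "l \<in> K" "m \<in> K" "l \<noteq> m" for l m
  proof -
    obtain x where x: "x \<in> l" "x \<in> m" using meet[OF lm(1,2)] by blast
    have "y = x" if "y \<in> l" "y \<in> m" for y
      using uniq[of l m y x] x that lm by blast
    then show ?thesis using x by blast
  qed
  show ?thesis
    unfolding projective_plane_of_order_def projective_plane_def
    using sub ex1 point quad card_l by (intro conjI ballI impI) simp_all
qed

context plane_of_order
begin

lemma inj_on_traces:
  assumes "S \<subseteq> P" "L0 \<subseteq> {l \<in> L. 2 \<le> card (l \<inter> S)}"
  shows "inj_on (\<lambda>l. l \<inter> S) L0"
proof (rule inj_onI)
  fix l m assume lm: "l \<in> L0" "m \<in> L0" "l \<inter> S = m \<inter> S"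
  then have L: "l \<in> L" "m \<in> L" and "\<not> card (l \<inter> S) \<le> Suc 0" using assms by auto
  then obtain x y where "x \<in> l \<inter> S" "y \<in> l \<inter> S" "x \<noteq> y"
    using finite_line by (auto simp: card_le_Suc0_iff_eq)
  then show "l = m" using line_unique[OF L, of x y] lm(3) by blast
qed

text \<open>The abstract structure is \<open>S\<close> with the traces of the lines in
  \<open>L0\<close>. Points embed by the identity, and a trace goes back to its line, which two
  common points determine.\<close>

lemma embedded_point_setI:
  assumes S: "S \<subseteq> P" "L0 \<subseteq> {l \<in> L. 2 \<le> card (l \<inter> S)}"
    and X: "X S ((\<lambda>l. l \<inter> S) ` L0)"
  shows "embedded_point_set X P L S"
  unfolding embedded_point_set_def
proof (intro exI conjI)
  let ?t = "\<lambda>l. l \<inter> S"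
  show "X S (?t ` L0)" by (rule X)
  show "S = (\<lambda>x. x) ` S" by simp
  have inj: "inj_on ?t L0" by (rule inj_on_traces[OF S])
  show "embedding (\<lambda>x. x) (inv_into L0 ?t) S (?t ` L0) P L"
    unfolding embedding_def
  proof (intro conjI)
    show "inj_on (inv_into L0 ?t) (?t ` L0)" by (rule inj_on_inv_into) simp
    show "inv_into L0 ?t ` (?t ` L0) \<subseteq> L"
      using inv_into_f_f[OF inj] S(2) by auto
    show "\<forall>x\<in>S. \<forall>l\<in>?t ` L0. (x \<in> l) = (x \<in> inv_into L0 ?t l)"
      using inv_into_f_f[OF inj] by auto
  qed (use S in auto)
qed

end

section \<open>Planes formed by the symbol classes\<close>

context light_word
begin

text \<open>A third symbol would make every nonzero symbol occur, which
  \<open>full_light_word_impossible\<close> rules out.\<close>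

lemma supp_eq_pts_Un:
  assumes a: "num a > 0" "a \<noteq> 0"
  shows "supp = pts a \<union> pts (- a)"
proof
  show "pts a \<union> pts (- a) \<subseteq> supp" using a by (auto simp: supp_def pts_def)
  show "supp \<subseteq> pts a \<union> pts (- a)"
  proof (rule ccontr)
    assume "\<not> supp \<subseteq> pts a \<union> pts (- a)"
    then obtain x where x: "x \<in> supp" "x \<notin> pts a" "x \<notin> pts (- a)" by blast
    define b where "b = v x"
    have b0: "b \<noteq> 0" using x by (simp add: b_def supp_def)
    have xb: "x \<in> pts b" using b0 by (simp add: in_pts_iff b_def)
    then have b: "num b > 0" "b \<noteq> a" "b \<noteq> - a" using num_pos_iff x by auto
    interpret full_light_word p P L v
      by unfold_locales (rule all_symbols_of_three[OF a b(1) b0 b(2,3)])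
    show False by (rule full_light_word_impossible)
  qed
qed

lemma card_Int_supp:
  assumes a: "num a > 0" "a \<noteq> 0"
  shows "card (X \<inter> supp) = card (X \<inter> pts a) + card (X \<inter> pts (- a))"
proof -
  have "X \<inter> supp = (X \<inter> pts a) \<union> (X \<inter> pts (- a))" using supp_eq_pts_Un[OF a] by auto
  moreover have "(X \<inter> pts a) \<inter> (X \<inter> pts (- a)) = {}"
    using neq_minus_self[OF a(2)] by (auto simp: pts_def)
  ultimately show ?thesis using finite_pts by (simp add: card_Un_disjoint)
qed

lemma lift_sum_two_symbols:
  assumes a: "num a > 0" "a \<noteq> 0" and X: "X \<subseteq> P"
  shows "lift_sum a X = card (X \<inter> pts a) + (p - 1) * card (X \<inter> pts (- a))"
proof -
  have fin: "finite X" by (rule finite_subset[OF X finite_points])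
  have "lift_sum a X = lift_sum a (X \<inter> supp)" by (rule lift_sum_Int_supp[OF fin])
  also have "X \<inter> supp = (X \<inter> pts a) \<union> (X \<inter> pts (- a))" using supp_eq_pts_Un[OF a] by auto
  also have "lift_sum a \<dots> = lift_sum a (X \<inter> pts a) + lift_sum a (X \<inter> pts (- a))"
    unfolding lift_sum_def using fin neq_minus_self[OF a(2)]
    by (intro sum.union_disjoint) (auto simp: pts_def)
  also have "\<dots> = card (X \<inter> pts a) * residue (a / a) + card (X \<inter> pts (- a)) * residue (- a / a)"
    by (simp only: lift_sum_Int_pts occ_def)
  also have "residue (- a / a) = p - 1"
    using residue_minus[of "1 :: 'r mod_ring"] card_r a(2) by simp
  finally show ?thesis using a(2) by simp
qed

text \<open>The lifted sums over \<open>P\<close> relative to \<open>a\<close> and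
  \<open>- a\<close> are two linear equations in the symbol counts. Their difference makes
  \<open>p - 2\<close> divide \<open>2 * (e - e')\<close>, whose absolute value is at most 4, so the
  excesses agree and then the counts do.\<close>

lemma two_symbol_counts:
  assumes a: "num a > 0" "a \<noteq> 0"
  shows "total_excess (- a) = total_excess a" "num (- a) = num a"
    "num a + p = p\<^sup>2 + 1 + total_excess a"
proof -
  have a': "num (- a) > 0" "- a \<noteq> 0" using num_neg_pos[OF a] a by auto
  define n n' e e' where "n = int (num a)" and "n' = int (num (- a))"
    and "e = int (total_excess a)" and "e' = int (total_excess (- a))"
  have p1: "int (p - 1) = int p - 1" using p_ge_7 by (simp add: of_nat_diff)
  have PI: "P \<inter> pts b = pts b" for b by (auto simp: pts_def)
  have "num a + (p - 1) * num (- a) + p\<^sup>2 = p * (p\<^sup>2 + 1 + total_excess a)"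
    using lift_sum_points_eq[OF a] lift_sum_two_symbols[OF a order.refl] by (simp add: PI num_def)
  from arg_cong[OF this, of int] have 1: "n + (int p - 1) * n' + (int p)\<^sup>2 = int p * ((int p)\<^sup>2 + 1 + e)"
    by (simp only: n_def n'_def e_def of_nat_add of_nat_mult of_nat_power of_nat_1 p1)
  have "num (- a) + (p - 1) * num a + p\<^sup>2 = p * (p\<^sup>2 + 1 + total_excess (- a))"
    using lift_sum_points_eq[OF a'] lift_sum_two_symbols[OF a' order.refl] by (simp add: PI num_def)
  from arg_cong[OF this, of int] have 2: "n' + (int p - 1) * n + (int p)\<^sup>2 = int p * ((int p)\<^sup>2 + 1 + e')"
    by (simp only: n_def n'_def e'_def of_nat_add of_nat_mult of_nat_power of_nat_1 p1)
  have diff: "(int p - 2) * (n' - n - (e - e')) = 2 * (e - e')"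
    using 1 2 by (simp add: algebra_simps)
  have small: "\<bar>2 * (e - e')\<bar> < int p - 2"
    using total_excess_add[OF a] eps_le_2 p_ge_7 by (simp add: e_def e'_def)
  have "2 * (e - e') = 0"
  proof (rule ccontr)
    assume nz: "2 * (e - e') \<noteq> 0"
    have "(int p - 2) dvd 2 * (e - e')" unfolding diff[symmetric] by simp
    then have "\<bar>int p - 2\<bar> \<le> \<bar>2 * (e - e')\<bar>" using nz by (rule dvd_imp_le_int[rotated])
    then show False using small by simp
  qed
  then have ee: "e = e'" by simp
  then have nn: "n = n'" using diff p_ge_7 by simp
  show "total_excess (- a) = total_excess a" "num (- a) = num a"
    using ee nn by (simp_all add: e_def e'_def n_def n'_def)
  have "int p * (n + int p) = int p * ((int p)\<^sup>2 + 1 + e)"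
    using 1 nn by (simp add: algebra_simps power2_eq_square)
  then have "n + int p = (int p)\<^sup>2 + 1 + e" using p_ge_7 by simp
  then have "int (num a + p) = int (p\<^sup>2 + 1 + total_excess a)" by (simp add: n_def e_def)
  then show "num a + p = p\<^sup>2 + 1 + total_excess a" by (simp only: of_nat_eq_iff)
qed

lemma two_symbol_total_excess:
  assumes a: "num a > 0" "a \<noteq> 0"
  shows "2 * total_excess a = eps" "total_excess a \<le> 1"
  using two_symbol_counts(1)[OF a] total_excess_add[OF a] eps_le_2 by linarith+

text \<open>Without \<open>- a\<close> on the line, its lifted sum is just \<open>occ l a\<close>.
  Otherwise the two lifted sums together show that the line has at most four support points, and the
  finitely many cases are checked.\<close>

lemma two_symbol_line:
  assumes a: "num a > 0" "a \<noteq> 0" and l: "l \<in> L" "x \<in> l" "x \<in> pts a"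
  shows "occ l a = 1 \<and> excess a l = 0 \<or> occ l a = 2 \<and> excess a l = 1 \<or> occ l a = p * (1 + excess a l)"
proof -
  have vx: "v x = a" using l a by (simp add: in_pts_iff)
  define m k j where "m = occ l a" and "k = occ l (- a)" and "j = excess a l"
  have m: "1 \<le> m" using occ_pos_iff[OF a(2), of l] l by (auto simp: m_def Suc_le_eq)
  have T: "m + (p - 1) * k = p * (1 + j)"
    using lift_sum_eq_excess[OF l(1,2) _ a(2)] vx a(2) lift_sum_two_symbols[OF a line_subset[OF l(1)]]
    by (simp add: m_def k_def j_def occ_def)
  show ?thesis
  proof (cases "k = 0")
    case True
    then show ?thesis using T by (simp add: m_def j_def)
  next
    case False
    have a': "num (- a) > 0" "- a \<noteq> 0" using num_neg_pos[OF a] a by auto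
    obtain y where y: "y \<in> l" "y \<in> pts (- a)" using False occ_pos_iff[OF a'(2), of l] by (auto simp: k_def)
    have vy: "v y = - a" using y a' by (simp add: in_pts_iff)
    have "p * (m + k) = p * (1 + j) + p * (1 + excess (- a) l)"
      using lift_sum_add_minus[OF line_subset[OF l(1)] a(2)] card_Int_supp[OF a, of l]
        lift_sum_eq_excess[OF l(1,2) _ a(2)] lift_sum_eq_excess[OF l(1) y(1) _ a'(2)] vx vy a(2)
      by (simp add: m_def k_def j_def occ_def)
    then have "p * (m + k) = p * (2 + j + excess (- a) l)" by (simp add: algebra_simps)
    then have mk: "m + k = 2 + j + excess (- a) l" using p_ge_7 by (simp only: mult_cancel1) simp
    have "j \<le> 1" "excess (- a) l \<le> 1"
      using excess_le_total[OF l a(2)] excess_le_total[OF l(1) y a'(2)] two_symbol_total_excess(2)[OF a]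
        two_symbol_counts(1)[OF a] by (auto simp: j_def)
    then have mk4: "m + k \<le> 4" using mk by simp
    obtain r where r: "p = r + 1" "6 \<le> r" using p_ge_7 by (intro that[of "p - 1"]) auto
    have T': "m + r * k = (r + 1) * (1 + j)" using T r by simp
    have "k = 1 \<or> k = 2 \<or> k = 3" using mk4 m False by linarith
    moreover have "j = 0 \<or> j = 1" using \<open>j \<le> 1\<close> by linarith
    ultimately have "m = 1 \<and> j = 0 \<or> m = 2 \<and> j = 1"
      using T' mk4 r(2) by (elim disjE) simp_all
    then show ?thesis by (auto simp: m_def j_def)
  qed
qed

lemma pts_pair_line:
  assumes xy: "x \<in> pts a" "y \<in> pts a" "x \<noteq> y"
  shows "\<exists>!l. l \<in> L \<and> x \<in> l \<and> y \<in> l"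
  using ex1_line[of x y] xy by (simp add: pts_def)

lemma two_le_occ:
  assumes "x \<in> pts a" "y \<in> pts a" "x \<noteq> y" "x \<in> l" "y \<in> l"
  shows "2 \<le> occ l a"
proof -
  have "card {x, y} \<le> card (l \<inter> pts a)"
    using assms finite_pts by (intro card_mono) auto
  then show ?thesis using assms(3) by (simp add: occ_def)
qed

text \<open>All excesses are 0, so a line with two points of symbol \<open>a\<close> has exactly
  \<open>p\<close> of them, and these traces join any two points of the class.\<close>

lemma embedded_projective_plane:
  assumes a: "num a > 0" "a \<noteq> 0" and eps: "eps = 0"
  shows "embedded_point_set (projective_plane_of_order (p - 1)) P L (pts a)"
proof (rule embedded_point_setI)
  let ?L0 = "{l \<in> L. 2 \<le> card (l \<inter> pts a)}"
  show "pts a \<subseteq> P" by (rule pts_subset)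
  show "?L0 \<subseteq> {l \<in> L. 2 \<le> card (l \<inter> pts a)}" by simp
  have te: "total_excess a = 0" using two_symbol_total_excess[OF a] eps by simp
  have card_p: "card (l \<inter> pts a) = p" if "l \<in> ?L0" for l
  proof -
    have l: "l \<in> L" "2 \<le> occ l a" using that by (auto simp: occ_def)
    then obtain x where x: "x \<in> l" "x \<in> pts a" using occ_pos_iff[OF a(2), of l] by auto
    have "excess a l = 0" using excess_le_total[OF l(1) x a(2)] te by simp
    then show ?thesis using two_symbol_line[OF a l(1) x] l(2) by (simp add: occ_def)
  qed
  show "projective_plane_of_order (p - 1) (pts a) ((\<lambda>l. l \<inter> pts a) ` ?L0)"
  proof (rule projective_plane_of_orderI)
    obtain r where r: "p = r + 1" using p_ge_7 by (intro that[of "p - 1"]) simp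
    show "card (pts a) = (p - 1)\<^sup>2 + (p - 1) + 1"
      using two_symbol_counts(3)[OF a] te unfolding num_def r by (simp add: power2_eq_square)
    show "2 \<le> p - 1" using p_ge_7 by simp
    show "finite (pts a)" by (rule finite_pts)
    show "(\<lambda>l. l \<inter> pts a) ` ?L0 \<subseteq> Pow (pts a)" by blast
    show "card k = p - 1 + 1" if k: "k \<in> (\<lambda>l. l \<inter> pts a) ` ?L0" for k
    proof -
      obtain l where "k = l \<inter> pts a" "l \<in> ?L0" using k by (rule imageE)
      then have "card k = p" using card_p[of l] by simp
      then show ?thesis using p_ge_7 by simp
    qed
    fix x y assume xy: "x \<in> pts a" "y \<in> pts a" "x \<noteq> y"
    obtain l where l: "l \<in> L" "x \<in> l" "y \<in> l" using pts_pair_line[OF xy] by blast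
    have l0: "l \<in> ?L0" using l(1) two_le_occ[OF xy l(2,3)] by (simp add: occ_def)
    show "\<exists>!k. k \<in> (\<lambda>l. l \<inter> pts a) ` ?L0 \<and> x \<in> k \<and> y \<in> k"
    proof (rule ex1I[of _ "l \<inter> pts a"])
      show "l \<inter> pts a \<in> (\<lambda>l. l \<inter> pts a) ` ?L0 \<and> x \<in> l \<inter> pts a \<and> y \<in> l \<inter> pts a"
        using imageI[OF l0] l xy by simp
      fix k assume k: "k \<in> (\<lambda>l. l \<inter> pts a) ` ?L0 \<and> x \<in> k \<and> y \<in> k"
      then obtain m where m: "k = m \<inter> pts a" "m \<in> ?L0" by (elim conjE imageE)
      then have "m = l" using line_unique[of m l x y] l k xy(3) by simp
      then show "k = l \<inter> pts a" using m by simp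
    qed
  qed
qed

text \<open>Such a line uses up the total excess 1 at each of its points of symbol \<open>a\<close>.
  Every line joining one of them to a point \<open>z\<close> of symbol \<open>a\<close> off
  \<open>l\<close> then has excess 0 and \<open>p\<close> points of symbol \<open>a\<close>, so
  \<open>num a\<close> is at least \<open>2 * p * (p - 1) + 1\<close>, which is too large.\<close>

lemma no_double_secant:
  assumes a: "num a > 0" "a \<noteq> 0" and eps: "eps = 2" and l: "l \<in> L" "x \<in> l" "x \<in> pts a"
  shows "occ l a \<noteq> p * 2"
proof
  assume l2: "occ l a = p * 2"
  have te: "total_excess a = 1" using two_symbol_total_excess[OF a] eps by simp
  have n: "num a + p = p\<^sup>2 + 2" using two_symbol_counts(3)[OF a] te by simp
  have pp: "7 * p \<le> p\<^sup>2" using p_ge_7 by (simp add: power2_eq_square)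
  have "\<not> pts a \<subseteq> l"
  proof
    assume "pts a \<subseteq> l"
    then have "num a = p * 2" using l2 by (simp add: num_def occ_def Int_absorb1)
    then show False using n pp p_ge_7 by linarith
  qed
  then obtain z where z: "z \<in> pts a" "z \<notin> l" by blast
  then have zP: "z \<in> P" by (simp add: pts_def)
  have exl: "excess a l = 1"
  proof -
    have "excess a l \<le> 1" using excess_le_total[OF l a(2)] te by simp
    moreover have "excess a l \<noteq> 0"
      using two_symbol_line[OF a l] l2 p_ge_7 by auto
    ultimately show ?thesis by simp
  qed
  \<comment> \<open>One bound covers both kinds of lines through \<open>z\<close>: those meeting
    \<open>l\<close> in symbol \<open>a\<close> have \<open>p\<close> such points, the others at
    least \<open>z\<close>.\<close>
  have line: "card (m \<inter> (l \<inter> pts a)) * (p - 1) + 1 \<le> occ m a" if m: "m \<in> L" "z \<in> m" for m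
  proof (cases "m \<inter> (l \<inter> pts a) = {}")
    case True
    then show ?thesis using occ_pos_iff[OF a(2), of m] m z by (auto simp: Suc_le_eq)
  next
    case False
    then obtain y where y: "y \<in> m" "y \<in> l" "y \<in> pts a" by blast
    have ml: "m \<noteq> l" using m z by auto
    have "card (m \<inter> (l \<inter> pts a)) \<le> card (m \<inter> l)"
      using finite_line[OF m(1)] by (intro card_mono) auto
    then have one: "card (m \<inter> (l \<inter> pts a)) \<le> 1" using card_Int_lines[OF m(1) l(1) ml] by simp
    have yP: "y \<in> P" using y by (simp add: pts_def)
    have "excess a m = 0"
    proof -
      have "(\<Sum>k\<in>{m, l}. excess a k) \<le> (\<Sum>k | k \<in> L \<and> y \<in> k. excess a k)"
        using m l y finite_pencil[OF yP] by (intro sum_mono2) auto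
      then show ?thesis using sum_excess[OF y(3) a(2)] te exl ml by simp
    qed
    moreover have "2 \<le> occ m a"
      using two_le_occ[OF z(1) y(3) _ m(2) y(1)] z y by blast
    ultimately have "occ m a = p" using two_symbol_line[OF a m(1) y(1,3)] by simp
    then show ?thesis using one p_ge_7 by (cases "card (m \<inter> (l \<inter> pts a))") auto
  qed
  have "(\<Sum>m | m \<in> L \<and> z \<in> m. card (m \<inter> (l \<inter> pts a)) * (p - 1)) + (\<Sum>m | m \<in> L \<and> z \<in> m. 1)
      \<le> (\<Sum>m | m \<in> L \<and> z \<in> m. occ m a)"
    unfolding sum.distrib[symmetric] using line by (intro sum_mono) auto
  moreover have "(\<Sum>m | m \<in> L \<and> z \<in> m. card (m \<inter> (l \<inter> pts a))) = p * 2"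
    using pencil_card[OF zP, of "l \<inter> pts a"] pts_subset z l2 by (auto simp: occ_def)
  ultimately have "p * 2 * (p - 1) + (p\<^sup>2 + 1) \<le> num a + p\<^sup>2"
    using sum_occ_pencil[OF zP, of a] z card_pencil[OF zP] a(2)
    by (simp add: sum_distrib_right[symmetric] in_pts_iff)
  moreover have "p * 2 * (p - 1) + 2 * p = 2 * p\<^sup>2"
    using p_ge_7 by (cases p) (simp_all add: power2_eq_square)
  ultimately show False using n pp p_ge_7 by linarith
qed

text \<open>Only lines with exactly \<open>p\<close> points of symbol \<open>a\<close> are kept.
  Each point of the class lies on a single line of excess 1, which has two such points and joins it
  to its antipode; the pencil count leaves \<open>p\<close> kept lines per point, and counting flags
  makes lines and points equinumerous.\<close>

lemma embedded_antipodal_plane: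
  assumes a: "num a > 0" "a \<noteq> 0" and eps: "eps = 2"
  shows "embedded_point_set (antipodal_plane_of_order (p - 1)) P L (pts a)"
proof (rule embedded_point_setI)
  let ?L0 = "{l \<in> L. card (l \<inter> pts a) = p}"
  let ?t = "\<lambda>l. l \<inter> pts a"
  show sub: "pts a \<subseteq> P" by (rule pts_subset)
  show L0: "?L0 \<subseteq> {l \<in> L. 2 \<le> card (l \<inter> pts a)}" using p_ge_7 by auto
  have te: "total_excess a = 1" using two_symbol_total_excess[OF a] eps by simp
  have n: "num a + p = p\<^sup>2 + 2" using two_symbol_counts(3)[OF a] te by simp
  have inj: "inj_on ?t ?L0" by (rule inj_on_traces[OF sub L0])
  have pencil: "card {k \<in> ?t ` ?L0. x \<in> k} = p" if x: "x \<in> pts a" for x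
  proof -
    have xP: "x \<in> P" and vx: "v x = a" using x by (auto simp: pts_def)
    have fin: "finite {l \<in> L. x \<in> l}" by (rule finite_pencil[OF xP])
    \<comment> \<open>With \<open>2 * p\<close> excluded, the pairs of \<open>occ l a\<close> and
      excess are (1, 0), (2, 1) and (\<open>p\<close>, 0).\<close>
    have "occ l a = 1 + ((p - 1) * of_bool (occ l a = p) + excess a l)" if "l \<in> {l \<in> L. x \<in> l}" for l
    proof -
      have l: "l \<in> L" "x \<in> l" using that by auto
      have "excess a l \<le> 1" using excess_le_total[OF l x a(2)] te by simp
      then have "excess a l = 0 \<or> excess a l = 1" by linarith
      then show ?thesis
        using two_symbol_line[OF a l x] no_double_secant[OF a eps l x] p_ge_7 by auto
    qed
    then have "(\<Sum>l | l \<in> L \<and> x \<in> l. occ l a) =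
        (\<Sum>l | l \<in> L \<and> x \<in> l. 1 + ((p - 1) * of_bool (occ l a = p) + excess a l))"
      by (rule sum.cong[OF refl])
    also have "\<dots> = (\<Sum>l | l \<in> L \<and> x \<in> l. 1) + ((\<Sum>l | l \<in> L \<and> x \<in> l. (p - 1) * of_bool (occ l a = p))
        + (\<Sum>l | l \<in> L \<and> x \<in> l. excess a l))"
      by (simp only: sum.distrib)
    also have "\<dots> = (p\<^sup>2 + 1) + ((p - 1) * (\<Sum>l | l \<in> L \<and> x \<in> l. of_bool (occ l a = p)) + 1)"
      using card_pencil[OF xP] sum_excess[OF x a(2)] te by (simp add: sum_distrib_left[symmetric])
    also have "(\<Sum>l | l \<in> L \<and> x \<in> l. of_bool (occ l a = p)) = card {l \<in> ?L0. x \<in> l}"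
    proof -
      have "{l \<in> L. x \<in> l} \<inter> {l. occ l a = p} = {l \<in> ?L0. x \<in> l}" by (auto simp: occ_def)
      then show ?thesis using fin by (simp add: of_bool_def sum.If_cases)
    qed
    finally have "num a + p\<^sup>2 = p\<^sup>2 + 1 + ((p - 1) * card {l \<in> ?L0. x \<in> l} + 1)"
      using sum_occ_pencil[OF xP, of a] vx by simp
    then have "(p - 1) * card {l \<in> ?L0. x \<in> l} + p = p\<^sup>2" using n by simp
    moreover obtain r where r: "p = r + 1" "r \<noteq> 0" using p_ge_7 by (intro that[of "p - 1"]) auto
    ultimately have "r * card {l \<in> ?L0. x \<in> l} = r * p" by (simp add: power2_eq_square)
    then have "card {l \<in> ?L0. x \<in> l} = p" using r(2) by (simp only: mult_cancel1) simp
    moreover have "{k \<in> ?t ` ?L0. x \<in> k} = ?t ` {l \<in> ?L0. x \<in> l}" using x by auto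
    moreover have "inj_on ?t {l \<in> ?L0. x \<in> l}" using inj by (rule inj_on_subset) auto
    ultimately show ?thesis by (simp add: card_image)
  qed
  have card_k: "card k = p" if "k \<in> ?t ` ?L0" for k using that by auto
  have finK: "finite (?t ` ?L0)" using finite_lines by simp
  have "(\<Sum>x\<in>pts a. card {k \<in> ?t ` ?L0. x \<in> k}) = (\<Sum>k\<in>?t ` ?L0. card {x \<in> pts a. x \<in> k})"
    using sum.swap_restrict[OF finite_pts[of a] finK, of "\<lambda>_ _. 1 :: nat" "\<lambda>x k. x \<in> k"] by simp
  also have "\<dots> = (\<Sum>k\<in>?t ` ?L0. p)"
  proof (rule sum.cong[OF refl])
    fix k assume k: "k \<in> ?t ` ?L0"
    then have "{x \<in> pts a. x \<in> k} = k" by auto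
    then show "card {x \<in> pts a. x \<in> k} = p" using card_k[OF k] by simp
  qed
  finally have "num a * p = card (?t ` ?L0) * p" using pencil by (simp add: num_def)
  then have cardK: "card (?t ` ?L0) = num a" using p_ge_7 by simp
  obtain r where r: "p = r + 1" using p_ge_7 by (intro that[of "p - 1"]) simp
  have num: "num a = (p - 1)\<^sup>2 + (p - 1) + 2" using n unfolding r by (simp add: power2_eq_square)
  show "antipodal_plane_of_order (p - 1) (pts a) (?t ` ?L0)"
    unfolding antipodal_plane_of_order_def partial_linear_space_def
  proof (intro conjI ballI impI)
    show "2 \<le> p - 1" using p_ge_7 by simp
    show "?t ` ?L0 \<subseteq> Pow (pts a)" by blast
    show "card (pts a) = (p - 1)\<^sup>2 + (p - 1) + 2" using num by (simp only: num_def)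
    show "card (?t ` ?L0) = (p - 1)\<^sup>2 + (p - 1) + 2" using num cardK by (simp only:)
    show "2 \<le> card k" "card k = p - 1 + 1" if "k \<in> ?t ` ?L0" for k
      using card_k[OF that] p_ge_7 by linarith+
    show "card {k \<in> ?t ` ?L0. x \<in> k} = p - 1 + 1" if "x \<in> pts a" for x
      using pencil[OF that] p_ge_7 by linarith
    fix x y k m
    assume "x \<noteq> y" "k \<in> ?t ` ?L0" "m \<in> ?t ` ?L0" and *: "x \<in> k \<and> y \<in> k \<and> x \<in> m \<and> y \<in> m"
    then obtain k' m' where km: "k' \<in> L" "k = ?t k'" "m' \<in> L" "m = ?t m'" by auto
    then have "k' = m'" using line_unique[of k' m' x y] * \<open>x \<noteq> y\<close> by auto
    then show "k = m" using km by simp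
  qed
qed

text \<open>Since \<open>eps\<close> is twice the common total excess of the two symbols, it is
  even, which rules out \<open>eps = 1\<close>.\<close>

theorem light_word_structure:
  assumes x: "x \<in> supp"
  defines "a \<equiv> v x"
  shows "v = (\<lambda>y. a * (incidence_vector (pts a) y - incidence_vector (pts (- a)) y))"
    and "eps = 0 \<and> embedded_point_set (projective_plane_of_order (p - 1)) P L (pts a)
          \<and> embedded_point_set (projective_plane_of_order (p - 1)) P L (pts (- a))
      \<or> eps = 2 \<and> embedded_point_set (antipodal_plane_of_order (p - 1)) P L (pts a)
          \<and> embedded_point_set (antipodal_plane_of_order (p - 1)) P L (pts (- a))"
proof -
  have a0: "a \<noteq> 0" using x by (simp add: a_def supp_def)
  have "x \<in> pts a" using a0 by (simp add: in_pts_iff a_def)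
  then have a: "num a > 0" "a \<noteq> 0" using num_pos_iff a0 by auto
  have a': "num (- a) > 0" "- a \<noteq> 0" using num_neg_pos[OF a] a by auto
  show "v = (\<lambda>y. a * (incidence_vector (pts a) y - incidence_vector (pts (- a)) y))"
  proof
    fix y
    have "v y = 0 \<or> v y = a \<or> v y = - a" using supp_eq_pts_Un[OF a] by (auto simp: supp_def pts_def)
    then show "v y = a * (incidence_vector (pts a) y - incidence_vector (pts (- a)) y)"
      using in_pts_iff[OF a0, of y] in_pts_iff[OF a'(2), of y] neq_minus_self[OF a0] a0
      by (auto simp: incidence_vector_def)
  qed
  have "eps = 0 \<or> eps = 2" using two_symbol_total_excess[OF a] by presburger
  then show "eps = 0 \<and> embedded_point_set (projective_plane_of_order (p - 1)) P L (pts a)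
          \<and> embedded_point_set (projective_plane_of_order (p - 1)) P L (pts (- a))
      \<or> eps = 2 \<and> embedded_point_set (antipodal_plane_of_order (p - 1)) P L (pts a)
          \<and> embedded_point_set (antipodal_plane_of_order (p - 1)) P L (pts (- a))"
    using embedded_projective_plane[OF a] embedded_projective_plane[OF a']
      embedded_antipodal_plane[OF a] embedded_antipodal_plane[OF a'] by blast
qed

end

subsection \<open>The minimum weight\<close>

lemma minimum_weight_le:
  "v \<in> C \<Longrightarrow> v \<noteq> (\<lambda>x. 0) \<Longrightarrow> minimum_weight C \<le> weight v"
  unfolding minimum_weight_def by (rule Least_le) blast

lemma minimum_weight_attained:
  assumes "v \<in> C" "v \<noteq> (\<lambda>x. 0)"
  obtains u where "u \<in> C" "u \<noteq> (\<lambda>x. 0)" "weight u = minimum_weight C"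
proof -
  have "\<exists>u\<in>C. u \<noteq> (\<lambda>x. 0) \<and> weight u = minimum_weight C"
    unfolding minimum_weight_def by (rule LeastI[of _ "weight v"]) (use assms in blast)
  then show ?thesis using that by blast
qed

lemma weight_incidence_diff:
  assumes "finite X" "finite Y"
  shows "weight (\<lambda>x. incidence_vector X x - incidence_vector Y x :: 'f::field) = card (X - Y) + card (Y - X)"
proof -
  have "{x. incidence_vector X x - incidence_vector Y x \<noteq> (0 :: 'f)} = (X - Y) \<union> (Y - X)"
    by (auto simp: incidence_vector_def split: if_splits)
  moreover have "card ((X - Y) \<union> (Y - X)) = card (X - Y) + card (Y - X)"
    by (rule card_Un_disjoint) (use assms in auto)
  ultimately show ?thesis by (simp only: weight_def)
qed

section \<open>Dual words from lines and Baer subplanes\<close>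

context plane_of_order
begin

lemma incidence_diff_in_dual:
  assumes "X \<subseteq> P" "Y \<subseteq> P"
    and "\<And>k. k \<in> L \<Longrightarrow> (of_nat (card (k \<inter> X)) :: 'f::field) = of_nat (card (k \<inter> Y))"
  shows "(\<lambda>x. incidence_vector X x - incidence_vector Y x :: 'f) \<in> dual_plane_code P L"
proof -
  have sum: "(\<Sum>x\<in>k. incidence_vector Z x :: 'f) = of_nat (card (k \<inter> Z))" if "k \<in> L" for k Z
    using finite_line[OF that] by (simp add: incidence_vector_def sum.If_cases)
  have "incidence_vector X x - incidence_vector Y x = (0 :: 'f)" if "x \<notin> P" for x
    using that assms(1,2) by (auto simp: incidence_vector_def)
  moreover have "(\<Sum>x\<in>k. incidence_vector X x - incidence_vector Y x) = (0 :: 'f)" if "k \<in> L" for k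
    using assms(3)[OF that] by (simp add: sum_subtractf sum[OF that])
  ultimately show ?thesis by (simp add: dual_plane_code_def point_vectors_def)
qed

lemma of_nat_card_Int_line:
  assumes "(of_nat n :: 'f::field) = 0" "k \<in> L" "l \<in> L"
  shows "(of_nat (card (k \<inter> l)) :: 'f) = 1"
  using assms card_line[OF assms(2)] card_Int_lines[OF assms(2,3)] by (cases "k = l") auto

text \<open>This is the Baer property. A line with two subplane points extends a subplane line. A
  line with none would meet the \<open>m\<^sup>2 + m + 1\<close> extended lines in distinct points,
  but it has only \<open>m\<^sup>2 + 1\<close>.\<close>

lemma embedded_square_root_plane_trace:
  assumes sub: "plane_of_order m P' L'" and emb: "embedding f g P' L' P L" and n: "n = m\<^sup>2"
  shows "\<And>l. l \<in> L' \<Longrightarrow> card (g l \<inter> f ` P') = m + 1"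
    and "\<And>k. k \<in> L \<Longrightarrow> card (k \<inter> f ` P') = 1 \<or> card (k \<inter> f ` P') = m + 1"
proof -
  interpret B: plane_of_order m P' L' by (rule sub)
  have inj_f: "inj_on f P'" and fP: "f ` P' \<subseteq> P" and inj_g: "inj_on g L'" and gL: "g ` L' \<subseteq> L"
    and inc: "\<And>x l. x \<in> P' \<Longrightarrow> l \<in> L' \<Longrightarrow> x \<in> l \<longleftrightarrow> f x \<in> g l"
    using emb by (auto simp: embedding_def)
  have trace: "g l \<inter> f ` P' = f ` l" if "l \<in> L'" for l
    using inc[OF _ that] B.line_subset[OF that] by auto
  show card_trace: "card (g l \<inter> f ` P') = m + 1" if l: "l \<in> L'" for l
  proof -
    have "inj_on f l" by (rule inj_on_subset[OF inj_f B.line_subset[OF l]])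
    then show ?thesis using trace[OF l] B.card_line[OF l] by (simp add: card_image)
  qed
  fix k assume k: "k \<in> L"
  show "card (k \<inter> f ` P') = 1 \<or> card (k \<inter> f ` P') = m + 1"
  proof (cases "k \<in> g ` L'")
    case True
    then obtain l where "k = g l" "l \<in> L'" by (rule imageE)
    then show ?thesis using card_trace by simp
  next
    case False
    have "card (k \<inter> f ` P') \<le> Suc 0"
    proof (rule ccontr)
      assume "\<not> card (k \<inter> f ` P') \<le> Suc 0"
      then obtain a b where ab: "a \<in> k \<inter> f ` P'" "b \<in> k \<inter> f ` P'" "a \<noteq> b"
        using finite_line[OF k] by (auto simp: card_le_Suc0_iff_eq)
      obtain x where x: "a = f x" "x \<in> P'" using ab(1) by auto
      obtain y where y: "b = f y" "y \<in> P'" using ab(2) by auto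
      have "x \<noteq> y" using ab x y by auto
      then obtain l where l: "l \<in> L'" "x \<in> l" "y \<in> l" using B.ex_line[OF x(2) y(2)] by metis
      have "g l \<in> L" using gL l(1) by auto
      moreover have "a \<in> g l" "b \<in> g l" using inc l x y by auto
      ultimately have "k = g l" using line_unique[OF k, of "g l" a b] ab by auto
      then show False using False l(1) by simp
    qed
    moreover have "k \<inter> f ` P' \<noteq> {}"
    proof
      assume empty: "k \<inter> f ` P' = {}"
      define h where "h l = (THE z. z \<in> g l \<and> z \<in> k)" for l
      have h: "h l \<in> g l \<and> h l \<in> k" if "l \<in> L'" for l
        unfolding h_def by (rule theI', rule ex1_point) (use that gL k False in auto)
      \<comment> \<open>Two extended lines meet in a point of the subplane, and \<open>k\<close>
        contains no such point.\<close>
      have "inj_on h L'"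
      proof (rule inj_onI, rule ccontr)
        fix l1 l2 assume l: "l1 \<in> L'" "l2 \<in> L'" "h l1 = h l2" "l1 \<noteq> l2"
        obtain x where x: "x \<in> l1" "x \<in> l2" using B.ex1_point[OF l(1,2,4)] by blast
        have xP: "x \<in> P'" using x l B.line_subset by blast
        have fx: "f x \<in> g l1" "f x \<in> g l2" using inc[OF xP] l x by auto
        have "g l1 \<noteq> g l2" using inj_g l by (auto simp: inj_on_def)
        moreover have "g l1 \<in> L" "g l2 \<in> L" using gL l by auto
        ultimately have "h l1 = f x"
          using line_unique[of "g l1" "g l2" "h l1" "f x"] h[OF l(1)] h[OF l(2)] l(3) fx by metis
        then show False using h[OF l(1)] xP empty by auto
      qed
      moreover have "h ` L' \<subseteq> k" using h by auto
      ultimately have "card L' \<le> card k" using finite_line[OF k] by (metis card_inj_on_le)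
      then show False using B.card_lines card_line[OF k] n B.n_pos by simp
    qed
    ultimately show ?thesis using finite_line[OF k] by (metis One_nat_def card_0_eq finite_Int le_SucE le_zero_eq)
  qed
qed

text \<open>The witness is the subplane minus one of its extended lines \<open>g l\<close>: modulo
  \<open>p\<close> every line meets both sets in 1 point. The supports keep \<open>m\<^sup>2\<close>
  and \<open>m\<^sup>2 - m\<close> points respectively.\<close>

lemma minimum_weight_le_of_embedded_plane:
  assumes m: "m \<ge> 1" "n = m\<^sup>2" "(of_nat m :: 'f::field) = 0"
    and B: "embedded_point_set (projective_plane_of_order m) P L B"
  shows "minimum_weight (dual_plane_code P L :: ('a \<Rightarrow> 'f) set) \<le> 2 * m\<^sup>2 - m"
proof -
  obtain P' :: "'a set" and L' f g where pl: "projective_plane_of_order m P' L'" and emb: "embedding f g P' L' P L"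
    and Beq: "B = f ` P'" using B unfolding embedded_point_set_def by blast
  interpret B: plane_of_order m P' L' by unfold_locales (use pl m in auto)
  have "plane_of_order m P' L'" by unfold_locales
  note tr = embedded_square_root_plane_trace[OF this emb m(2), folded Beq]
  obtain l where l: "l \<in> L'" using B.ex_two_lines by metis
  have gl: "g l \<in> L" and BP: "B \<subseteq> P" using emb l by (auto simp: embedding_def Beq)
  have fin: "finite B" "finite (g l)" using finite_subset[OF BP finite_points] finite_line[OF gl] .
  define w where "w = (\<lambda>x. incidence_vector B x - incidence_vector (g l) x :: 'f)"
  have "card B = m\<^sup>2 + m + 1"
    using emb B.card_points by (simp add: Beq embedding_def card_image)
  then have c1: "card (B - g l) = m\<^sup>2"
    using fin tr(1)[OF l] by (simp add: card_Diff_subset_Int Int_commute)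
  have c2: "card (g l - B) = m\<^sup>2 - m"
    using fin tr(1)[OF l] card_line[OF gl] m(2) by (simp add: card_Diff_subset_Int)
  have wt: "weight w = m\<^sup>2 + (m\<^sup>2 - m)"
    unfolding w_def weight_incidence_diff[OF fin] c1 c2 ..
  have "w \<in> dual_plane_code P L"
    unfolding w_def
  proof (rule incidence_diff_in_dual[OF BP line_subset[OF gl]])
    fix k assume k: "k \<in> L"
    have "(of_nat n :: 'f) = 0" using m by simp
    then show "(of_nat (card (k \<inter> B)) :: 'f) = of_nat (card (k \<inter> g l))"
      using of_nat_card_Int_line[OF _ k gl, where 'f='f] tr(2)[OF k] m(3) by auto
  qed
  moreover have "w \<noteq> (\<lambda>x. 0)"
  proof
    assume "w = (\<lambda>x. 0)"
    then have "weight w = 0" by (simp add: weight_def)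
    then show False using wt m(1) by simp
  qed
  ultimately have "minimum_weight (dual_plane_code P L :: ('a \<Rightarrow> 'f) set) \<le> weight w"
    by (rule minimum_weight_le)
  moreover have "m \<le> m\<^sup>2" using m(1) by (simp add: power2_eq_square)
  ultimately show ?thesis using wt by simp
qed

text \<open>The difference of two lines works; without a nonzero word the \<open>LEAST\<close> in
  \<open>minimum_weight\<close> would be meaningless.\<close>

lemma ex_dual_word:
  assumes "(of_nat n :: 'f::field) = 0"
  obtains w :: "'a \<Rightarrow> 'f::field" where "w \<in> dual_plane_code P L" "w \<noteq> (\<lambda>x. 0)"
proof -
  obtain l m where lm: "l \<in> L" "m \<in> L" "l \<noteq> m" by (rule ex_two_lines)
  define w where "w = (\<lambda>x. incidence_vector l x - incidence_vector m x :: 'f)"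
  have "w \<in> dual_plane_code P L"
    unfolding w_def using of_nat_card_Int_line[OF assms] lm line_subset
    by (intro incidence_diff_in_dual) auto
  moreover have "w \<noteq> (\<lambda>x. 0)"
  proof
    assume "w = (\<lambda>x. 0)"
    then have "x \<in> l \<longleftrightarrow> x \<in> m" for x
      unfolding w_def by (auto simp: incidence_vector_def fun_eq_iff split: if_splits)
    then show False using lm(3) by blast
  qed
  ultimately show ?thesis by (rule that)
qed

end

text \<open>Treating all light words, not just those of minimum weight, yields both the gaps in the
  possible minimum weights and the shape of the minimum words. The witnesses are
  \<open>pts a\<close> and \<open>pts (- a)\<close> for an occurring symbol
  \<open>a\<close>.\<close>

lemma light_dual_word_cases:
  fixes v :: "'a \<Rightarrow> 'r::prime_card mod_ring"
  assumes "CARD('r) = p" "p \<ge> 7" "projective_plane_of_order (p\<^sup>2) P L"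
    and v: "v \<in> dual_plane_code P L" "v \<noteq> (\<lambda>x. 0)" "weight v \<le> 2 * p\<^sup>2 - 2 * p + 4"
  shows "\<exists>c S\<^sub>1 S\<^sub>2. c \<noteq> 0 \<and> S\<^sub>1 \<inter> S\<^sub>2 = {} \<and>
    v = (\<lambda>x. c * (incidence_vector S\<^sub>1 x - incidence_vector S\<^sub>2 x)) \<and>
    (weight v = 2 * p\<^sup>2 - 2 * p + 2 \<and>
       embedded_point_set (projective_plane_of_order (p - 1)) P L S\<^sub>1 \<and>
       embedded_point_set (projective_plane_of_order (p - 1)) P L S\<^sub>2 \<or>
     weight v = 2 * p\<^sup>2 - 2 * p + 4 \<and>
       embedded_point_set (antipodal_plane_of_order (p - 1)) P L S\<^sub>1 \<and>
       embedded_point_set (antipodal_plane_of_order (p - 1)) P L S\<^sub>2)"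
proof -
  interpret dual_word p P L v by unfold_locales (use assms in auto)
  have w: "weight v = card supp" by (simp add: weight_def supp_def)
  have pp: "2 * p \<le> 2 * p\<^sup>2" using assms(2) by (simp add: power2_eq_square)
  interpret light_word p P L v by unfold_locales (use v(3) w pp in linarith)
  obtain x where x: "x \<in> supp" using v(2) by (auto simp: supp_def fun_eq_iff)
  define a where "a = v x"
  have a0: "a \<noteq> 0" using x by (simp add: a_def supp_def)
  have "x \<in> pts a" using a0 by (simp add: in_pts_iff a_def)
  then have "num a > 0" using num_pos_iff by auto
  then have wt: "weight v + 2 * p = 2 * p\<^sup>2 + 2 + eps" using card_supp_eps a0 w by simp
  have e: "eps = 0 \<Longrightarrow> weight v = 2 * p\<^sup>2 - 2 * p + 2" "eps = 2 \<Longrightarrow> weight v = 2 * p\<^sup>2 - 2 * p + 4"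
    using wt pp by linarith+
  note st = light_word_structure[OF x, folded a_def]
  show ?thesis
  proof (intro exI conjI)
    show "a \<noteq> 0" by (rule a0)
    show "pts a \<inter> pts (- a) = {}" using neq_minus_self[OF a0] by (auto simp: pts_def)
    show "v = (\<lambda>x. a * (incidence_vector (pts a) x - incidence_vector (pts (- a)) x))" by (rule st(1))
    show "weight v = 2 * p\<^sup>2 - 2 * p + 2 \<and>
       embedded_point_set (projective_plane_of_order (p - 1)) P L (pts a) \<and>
       embedded_point_set (projective_plane_of_order (p - 1)) P L (pts (- a)) \<or>
     weight v = 2 * p\<^sup>2 - 2 * p + 4 \<and>
       embedded_point_set (antipodal_plane_of_order (p - 1)) P L (pts a) \<and>
       embedded_point_set (antipodal_plane_of_order (p - 1)) P L (pts (- a))"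
      using st(2) e by (elim disjE conjE) simp_all
  qed
qed

theorem mainTheorem1:
  fixes P :: "'a set" and L :: "'a set set" and p :: nat
    and D :: "('a \<Rightarrow> 'r::prime_card mod_ring) set"
  assumes "prime p" and "p \<ge> 7" and "CARD('r) = p"
    and "projective_plane_of_order (p\<^sup>2) P L"
  defines "D \<equiv> dual_plane_code P L"
  shows "(minimum_weight D = 2 * p\<^sup>2 - 2 * p + 2 \<or>
          minimum_weight D = 2 * p\<^sup>2 - 2 * p + 4 \<or>
          minimum_weight D \<ge> 2 * p\<^sup>2 - 2 * p + 5) \<and>
    (minimum_weight D = 2 * p\<^sup>2 - 2 * p + 2 \<longrightarrow>
       (\<forall>v\<in>D. weight v = minimum_weight D \<longrightarrow>
          (\<exists>c S\<^sub>1 S\<^sub>2. c \<noteq> 0 \<and> S\<^sub>1 \<inter> S\<^sub>2 = {} \<and>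
             embedded_point_set (projective_plane_of_order (p - 1)) P L S\<^sub>1 \<and>
             embedded_point_set (projective_plane_of_order (p - 1)) P L S\<^sub>2 \<and>
             v = (\<lambda>x. c * (incidence_vector S\<^sub>1 x - incidence_vector S\<^sub>2 x))))) \<and>
    (minimum_weight D = 2 * p\<^sup>2 - 2 * p + 4 \<longrightarrow>
       (\<forall>v\<in>D. weight v = minimum_weight D \<longrightarrow>
          (\<exists>c S\<^sub>1 S\<^sub>2. c \<noteq> 0 \<and> S\<^sub>1 \<inter> S\<^sub>2 = {} \<and>
             embedded_point_set (antipodal_plane_of_order (p - 1)) P L S\<^sub>1 \<and>
             embedded_point_set (antipodal_plane_of_order (p - 1)) P L S\<^sub>2 \<and>
             v = (\<lambda>x. c * (incidence_vector S\<^sub>1 x - incidence_vector S\<^sub>2 x))))) \<and>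
    ((\<exists>B. embedded_point_set (projective_plane_of_order p) P L B) \<longrightarrow>
       minimum_weight D \<le> 2 * p\<^sup>2 - p)"
proof -
  interpret plane_of_order "p\<^sup>2" P L by unfold_locales (use assms in auto)
  have p0: "(of_nat p :: 'r mod_ring) = 0"
    using of_nat_mod_ring_eq_0_iff[of p, where 'r='r] assms(3) by simp
  then have q0: "(of_nat (p\<^sup>2) :: 'r mod_ring) = 0" by simp
  note light_cases = light_dual_word_cases[OF assms(3,2,4), folded D_def]
  \<comment> \<open>The claims on minimum words range over all of \<open>D\<close>, so the zero
    vector must be excluded before \<open>light_cases\<close> applies.\<close>
  have nonzero: "v \<noteq> (\<lambda>x. 0)" if "weight v = 2 * p\<^sup>2 - 2 * p + k" "k > 0" for v :: "'a \<Rightarrow> 'r mod_ring" and k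
    using that by (auto simp: weight_def)
  obtain w :: "'a \<Rightarrow> 'r mod_ring" where w: "w \<in> D" "w \<noteq> (\<lambda>x. 0)"
    using ex_dual_word[OF q0] unfolding D_def by blast
  obtain u where u: "u \<in> D" "u \<noteq> (\<lambda>x. 0)" "weight u = minimum_weight D"
    by (rule minimum_weight_attained[OF w])
  have "minimum_weight D = 2 * p\<^sup>2 - 2 * p + 2 \<or> minimum_weight D = 2 * p\<^sup>2 - 2 * p + 4 \<or>
      minimum_weight D \<ge> 2 * p\<^sup>2 - 2 * p + 5"
  proof (cases "weight u \<le> 2 * p\<^sup>2 - 2 * p + 4")
    case True
    then show ?thesis using light_cases[OF u(1,2) True] u(3) by auto
  next
    case False
    then show ?thesis using u(3) by simp
  qed
  moreover have "\<exists>c S\<^sub>1 S\<^sub>2. c \<noteq> 0 \<and> S\<^sub>1 \<inter> S\<^sub>2 = {} \<and>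
      embedded_point_set (projective_plane_of_order (p - 1)) P L S\<^sub>1 \<and>
      embedded_point_set (projective_plane_of_order (p - 1)) P L S\<^sub>2 \<and>
      v = (\<lambda>x. c * (incidence_vector S\<^sub>1 x - incidence_vector S\<^sub>2 x))"
    if vD: "v \<in> D" "weight v = 2 * p\<^sup>2 - 2 * p + 2" for v
  proof -
    obtain c S\<^sub>1 S\<^sub>2 where "c \<noteq> 0" "S\<^sub>1 \<inter> S\<^sub>2 = {}"
      "v = (\<lambda>x. c * (incidence_vector S\<^sub>1 x - incidence_vector S\<^sub>2 x))"
      "embedded_point_set (projective_plane_of_order (p - 1)) P L S\<^sub>1"
      "embedded_point_set (projective_plane_of_order (p - 1)) P L S\<^sub>2"
      using light_cases[of v] vD nonzero[OF vD(2)] by auto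
    then show ?thesis by blast
  qed
  moreover have "\<exists>c S\<^sub>1 S\<^sub>2. c \<noteq> 0 \<and> S\<^sub>1 \<inter> S\<^sub>2 = {} \<and>
      embedded_point_set (antipodal_plane_of_order (p - 1)) P L S\<^sub>1 \<and>
      embedded_point_set (antipodal_plane_of_order (p - 1)) P L S\<^sub>2 \<and>
      v = (\<lambda>x. c * (incidence_vector S\<^sub>1 x - incidence_vector S\<^sub>2 x))"
    if vD: "v \<in> D" "weight v = 2 * p\<^sup>2 - 2 * p + 4" for v
  proof -
    obtain c S\<^sub>1 S\<^sub>2 where "c \<noteq> 0" "S\<^sub>1 \<inter> S\<^sub>2 = {}"
      "v = (\<lambda>x. c * (incidence_vector S\<^sub>1 x - incidence_vector S\<^sub>2 x))"
      "embedded_point_set (antipodal_plane_of_order (p - 1)) P L S\<^sub>1"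
      "embedded_point_set (antipodal_plane_of_order (p - 1)) P L S\<^sub>2"
      using light_cases[of v] vD nonzero[OF vD(2)] by auto
    then show ?thesis by blast
  qed
  moreover have "minimum_weight D \<le> 2 * p\<^sup>2 - p"
    if "embedded_point_set (projective_plane_of_order p) P L B" for B
    using minimum_weight_le_of_embedded_plane[OF _ refl p0 that] assms(2) by (simp add: D_def)
  ultimately show ?thesis by (intro conjI impI ballI) (auto simp only:)
qed

end
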